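(* Let $k$ be a field and let $G$ be an infinite locally finite group. Then the group algebra $kG$ is a locally Frobenius Hopf algebra.
   Context: A countable group $G$ is locally finite if every finite subset $S\subseteq G$ is contained in a finite subgroup. The group algebra $kG$ has its standard Hopf algebra structure. For a finite dimensional Hopf algebra $R$ with counit $\epsilon$, the spaces of left and right integrals are $\{h\in R:\forall y\in R,\ yh=\epsilon(y)h\}$ and $\{h\in R:\forall y\in R,\ hy=\epsilon(y)h\}$; $R$ is unimodular if these coincide, and involutive if the square of the antipode is the identity. Shape: $(\Lambda,\preccurlyeq,\lambda_0)$ is an infinite partially ordered set such that any two elements have a common upper bound, $\lambda_0$ is a unique initial element, and for every $\lambda\in\Lambda$ there is $\lambda'\in\Lambda$ with $\lambda\preccurlyeq\lambda'$, $\lambda\ne\lambda'$. A Hopf algebra $H$ over $k$ is a locally Frobenius Hopf algebra if for some such $\Lambda$ there is a $\Lambda$-directed system of finite dimensional subHopf algebras $H(\lambda)\subseteq H$ ($\lambda\in\Lambda$), with proper inclusions $H(\lambda')\hookrightarrow H(\lambda'')$ for $\lambda'\preccurlyeq\lambda''$, $\lambda'\ne\lambda''$, such that $H(\lambda_0)=k$, $H=\bigcup_{\lambda\in\Lambda}H(\lambda)$, and each $H(\lambda)$ is involutive and unimodular. *)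

theory Defs
  imports "HOL-Algebra.Module" "HOL-Algebra.AbelCoset" "HOL-Library.Countable_Set"
begin

section \<open>Free modules, quotients and tensor products\<close>

text \<open>
  The free module on a set \<open>U\<close> consists of the finitely supported functions on \<open>U\<close>, extended by
  \<open>\<zero>\<close> outside \<open>U\<close>.  The fields \<open>mult\<close> and \<open>one\<close> of the underlying ring record are irrelevant for
  a module and left undefined.
\<close>

definition free_module :: "('a, 'r) ring_scheme \<Rightarrow> 'x set \<Rightarrow> ('a, 'x \<Rightarrow> 'a) module" where
  "free_module K U =
    \<lparr> carrier = {f. (\<forall>x. f x \<in> carrier K) \<and> finite {x. f x \<noteq> \<zero>\<^bsub>K\<^esub>} \<and> {x. f x \<noteq> \<zero>\<^bsub>K\<^esub>} \<subseteq> U},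
      monoid.mult = undefined, one = undefined,
      ring.zero = (\<lambda>x. \<zero>\<^bsub>K\<^esub>),
      add = (\<lambda>f g x. f x \<oplus>\<^bsub>K\<^esub> g x),
      smult = (\<lambda>c f x. c \<otimes>\<^bsub>K\<^esub> f x) \<rparr>"

definition basis_vec :: "('a, 'r) ring_scheme \<Rightarrow> 'x \<Rightarrow> 'x \<Rightarrow> 'a" where
  "basis_vec K x = (\<lambda>y. if y = x then \<one>\<^bsub>K\<^esub> else \<zero>\<^bsub>K\<^esub>)"

text \<open>The linear extension to a free module of a map \<open>\<phi>\<close> given on the basis.\<close>

definition lin_ext ::
  "('a, 'r) ring_scheme \<Rightarrow> ('a, 'p, 's) module_scheme \<Rightarrow> ('x \<Rightarrow> 'p) \<Rightarrow> ('x \<Rightarrow> 'a) \<Rightarrow> 'p" where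
  "lin_ext K P \<phi> f = (\<Oplus>\<^bsub>P\<^esub>x\<in>{x. f x \<noteq> \<zero>\<^bsub>K\<^esub>}. f x \<odot>\<^bsub>P\<^esub> \<phi> x)"

definition module_span ::
  "('a, 'r) ring_scheme \<Rightarrow> ('a, 'm, 's) module_scheme \<Rightarrow> 'm set \<Rightarrow> 'm set" where
  "module_span K M S = \<Inter> {N. submodule N K M \<and> S \<subseteq> N}"

definition quotient_module ::
  "('a, 'r) ring_scheme \<Rightarrow> ('a, 'm, 's) module_scheme \<Rightarrow> 'm set \<Rightarrow> ('a, 'm set) module" where
  "quotient_module K M N =
    \<lparr> carrier = a_rcosets\<^bsub>M\<^esub> N,
      monoid.mult = undefined, one = undefined,
      ring.zero = N,
      add = (\<lambda>U V. U <+>\<^bsub>M\<^esub> V),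
      smult = (\<lambda>c U. \<Union>x\<in>U. N +>\<^bsub>M\<^esub> (c \<odot>\<^bsub>M\<^esub> x)) \<rparr>"

definition linear_map ::
  "('a, 'r) ring_scheme \<Rightarrow> ('a, 'm, 's) module_scheme \<Rightarrow> ('a, 'n, 't) module_scheme \<Rightarrow>
    ('m \<Rightarrow> 'n) \<Rightarrow> bool" where
  "linear_map K M N f \<longleftrightarrow>
    f \<in> carrier M \<rightarrow> carrier N \<and>
    (\<forall>x\<in>carrier M. \<forall>y\<in>carrier M. f (x \<oplus>\<^bsub>M\<^esub> y) = f x \<oplus>\<^bsub>N\<^esub> f y) \<and>
    (\<forall>c\<in>carrier K. \<forall>x\<in>carrier M. f (c \<odot>\<^bsub>M\<^esub> x) = c \<odot>\<^bsub>N\<^esub> f x)"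

definition bilinear_relations ::
  "('a, 'r) ring_scheme \<Rightarrow> ('a, 'm, 's) module_scheme \<Rightarrow> ('a, 'n, 't) module_scheme \<Rightarrow>
    ('m \<times> 'n \<Rightarrow> 'a) set" where
  "bilinear_relations K M N =
    (let F = free_module K (carrier M \<times> carrier N); e = (\<lambda>x y. basis_vec K (x, y)) in
      {e (x \<oplus>\<^bsub>M\<^esub> x') y \<ominus>\<^bsub>F\<^esub> (e x y \<oplus>\<^bsub>F\<^esub> e x' y) | x x' y.
        x \<in> carrier M \<and> x' \<in> carrier M \<and> y \<in> carrier N} \<union>
      {e x (y \<oplus>\<^bsub>N\<^esub> y') \<ominus>\<^bsub>F\<^esub> (e x y \<oplus>\<^bsub>F\<^esub> e x y') | x y y'.
        x \<in> carrier M \<and> y \<in> carrier N \<and> y' \<in> carrier N} \<union>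
      {e (c \<odot>\<^bsub>M\<^esub> x) y \<ominus>\<^bsub>F\<^esub> (c \<odot>\<^bsub>F\<^esub> e x y) | c x y.
        c \<in> carrier K \<and> x \<in> carrier M \<and> y \<in> carrier N} \<union>
      {e x (c \<odot>\<^bsub>N\<^esub> y) \<ominus>\<^bsub>F\<^esub> (c \<odot>\<^bsub>F\<^esub> e x y) | c x y.
        c \<in> carrier K \<and> x \<in> carrier M \<and> y \<in> carrier N})"

definition bilinear_kernel ::
  "('a, 'r) ring_scheme \<Rightarrow> ('a, 'm, 's) module_scheme \<Rightarrow> ('a, 'n, 't) module_scheme \<Rightarrow>
    ('m \<times> 'n \<Rightarrow> 'a) set" where
  "bilinear_kernel K M N =
    module_span K (free_module K (carrier M \<times> carrier N)) (bilinear_relations K M N)"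

definition tensor_module ::
  "('a, 'r) ring_scheme \<Rightarrow> ('a, 'm, 's) module_scheme \<Rightarrow> ('a, 'n, 't) module_scheme \<Rightarrow>
    ('a, ('m \<times> 'n \<Rightarrow> 'a) set) module" where
  "tensor_module K M N =
    quotient_module K (free_module K (carrier M \<times> carrier N)) (bilinear_kernel K M N)"

definition pure_tensor ::
  "('a, 'r) ring_scheme \<Rightarrow> ('a, 'm, 's) module_scheme \<Rightarrow> ('a, 'n, 't) module_scheme \<Rightarrow>
    'm \<Rightarrow> 'n \<Rightarrow> ('m \<times> 'n \<Rightarrow> 'a) set" where
  "pure_tensor K M N x y =
    bilinear_kernel K M N +>\<^bsub>free_module K (carrier M \<times> carrier N)\<^esub> basis_vec K (x, y)"

text \<open>
  The linear map \<open>M \<otimes> N \<rightarrow> P\<close>, \<open>x \<otimes> y \<mapsto> \<beta> x y\<close> induced by a bilinear map \<open>\<beta>\<close>: the linear extension of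
  \<open>\<beta>\<close> to the free module is constant on every coset of the bilinear relations, and the map takes
  the coset to this common value.
\<close>

definition tensor_lift ::
  "('a, 'r) ring_scheme \<Rightarrow> ('a, 'p, 's) module_scheme \<Rightarrow> ('m \<Rightarrow> 'n \<Rightarrow> 'p) \<Rightarrow>
    ('m \<times> 'n \<Rightarrow> 'a) set \<Rightarrow> 'p" where
  "tensor_lift K P \<beta> U = the_elem (lin_ext K P (\<lambda>(x, y). \<beta> x y) ` U)"

text \<open>\<open>f \<otimes> g\<close> for linear maps \<open>f\<close>, \<open>g\<close> with codomains \<open>M'\<close>, \<open>N'\<close>.\<close>

definition tensor_map ::
  "('a, 'r) ring_scheme \<Rightarrow> ('a, 'p, 's) module_scheme \<Rightarrow> ('a, 'q, 't) module_scheme \<Rightarrow>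
    ('m \<Rightarrow> 'p) \<Rightarrow> ('n \<Rightarrow> 'q) \<Rightarrow> ('m \<times> 'n \<Rightarrow> 'a) set \<Rightarrow> ('p \<times> 'q \<Rightarrow> 'a) set" where
  "tensor_map K M' N' f g =
    tensor_lift K (tensor_module K M' N') (\<lambda>x y. pure_tensor K M' N' (f x) (g y))"

text \<open>The associativity isomorphism \<open>(L \<otimes> M) \<otimes> N \<rightarrow> L \<otimes> (M \<otimes> N)\<close>.\<close>

definition tensor_assoc where
  "tensor_assoc K L M N =
    (let T = tensor_module K L (tensor_module K M N) in
      tensor_lift K T (\<lambda>u z.
        tensor_lift K T (\<lambda>x y.
          pure_tensor K L (tensor_module K M N) x (pure_tensor K M N y z)) u))"

text \<open>The tensor product of algebras, with \<open>(a \<otimes> b) (a' \<otimes> b') = a a' \<otimes> b b'\<close>.\<close>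

definition tensor_algebra where
  "tensor_algebra K A B =
    (let T = tensor_module K A B in
      T \<lparr> monoid.mult := (\<lambda>u v. tensor_lift K T (\<lambda>a b.
                    tensor_lift K T (\<lambda>a' b'.
                      pure_tensor K A B (a \<otimes>\<^bsub>A\<^esub> a') (b \<otimes>\<^bsub>B\<^esub> b')) v) u),
          one := pure_tensor K A B \<one>\<^bsub>A\<^esub> \<one>\<^bsub>B\<^esub> \<rparr>)"


section \<open>Hopf algebras\<close>

text \<open>In contrast to \<^locale>\<open>algebra\<close>, the multiplication need not be commutative.\<close>

locale assoc_algebra = module R M + ring M for R (structure) and M (structure) +
  assumes smult_mult_left:
      "\<lbrakk>c \<in> carrier R; x \<in> carrier M; y \<in> carrier M\<rbrakk> \<Longrightarrow>
        (c \<odot>\<^bsub>M\<^esub> x) \<otimes>\<^bsub>M\<^esub> y = c \<odot>\<^bsub>M\<^esub> (x \<otimes>\<^bsub>M\<^esub> y)"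
    and smult_mult_right:
      "\<lbrakk>c \<in> carrier R; x \<in> carrier M; y \<in> carrier M\<rbrakk> \<Longrightarrow>
        x \<otimes>\<^bsub>M\<^esub> (c \<odot>\<^bsub>M\<^esub> y) = c \<odot>\<^bsub>M\<^esub> (x \<otimes>\<^bsub>M\<^esub> y)"

record ('a, 'h) hopf = "('a, 'h) module" +
  comult :: "'h \<Rightarrow> ('h \<times> 'h \<Rightarrow> 'a) set"
  counit :: "'h \<Rightarrow> 'a"
  antipode :: "'h \<Rightarrow> 'h"

locale hopf_algebra = field K + assoc_algebra K H
  for K :: "('a, 'r) ring_scheme" (structure)
    and H :: "('a, 'h, 's) hopf_scheme" (structure) +
  assumes comult_linear: "linear_map K H (tensor_module K H H) (comult H)"
    and comult_ring_hom: "comult H \<in> ring_hom H (tensor_algebra K H H)"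
    and counit_ring_hom: "counit H \<in> ring_hom H K"
    and counit_smult:
      "\<lbrakk>c \<in> carrier K; h \<in> carrier H\<rbrakk> \<Longrightarrow> counit H (c \<odot>\<^bsub>H\<^esub> h) = c \<otimes>\<^bsub>K\<^esub> counit H h"
    and coassoc:
      "h \<in> carrier H \<Longrightarrow>
        tensor_assoc K H H H (tensor_map K (tensor_module K H H) H (comult H) id (comult H h)) =
        tensor_map K H (tensor_module K H H) id (comult H) (comult H h)"
    and counit_left:
      "h \<in> carrier H \<Longrightarrow> tensor_lift K H (\<lambda>x y. counit H x \<odot>\<^bsub>H\<^esub> y) (comult H h) = h"
    and counit_right:
      "h \<in> carrier H \<Longrightarrow> tensor_lift K H (\<lambda>x y. counit H y \<odot>\<^bsub>H\<^esub> x) (comult H h) = h"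
    and antipode_linear: "linear_map K H H (antipode H)"
    and antipode_left:
      "h \<in> carrier H \<Longrightarrow>
        tensor_lift K H (\<lambda>x y. antipode H x \<otimes>\<^bsub>H\<^esub> y) (comult H h) = counit H h \<odot>\<^bsub>H\<^esub> \<one>\<^bsub>H\<^esub>"
    and antipode_right:
      "h \<in> carrier H \<Longrightarrow>
        tensor_lift K H (\<lambda>x y. x \<otimes>\<^bsub>H\<^esub> antipode H y) (comult H h) = counit H h \<odot>\<^bsub>H\<^esub> \<one>\<^bsub>H\<^esub>"

text \<open>
  For a subspace \<open>A\<close> of \<open>H\<close>, the subspace \<open>A \<otimes> A\<close> of \<open>H \<otimes> H\<close> is the span of the tensors
  \<open>a \<otimes> b\<close> with \<open>a, b \<in> A\<close>.
\<close>

definition sub_hopf_algebra ::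
  "('a, 'r) ring_scheme \<Rightarrow> ('a, 'h, 's) hopf_scheme \<Rightarrow> 'h set \<Rightarrow> bool" where
  "sub_hopf_algebra K H A \<longleftrightarrow>
    submodule A K H \<and>
    \<one>\<^bsub>H\<^esub> \<in> A \<and> (\<forall>x\<in>A. \<forall>y\<in>A. x \<otimes>\<^bsub>H\<^esub> y \<in> A) \<and>
    (\<forall>x\<in>A. comult H x \<in>
      module_span K (tensor_module K H H) {pure_tensor K H H a b | a b. a \<in> A \<and> b \<in> A}) \<and>
    (\<forall>x\<in>A. antipode H x \<in> A)"

text \<open>
  A subHopf algebra \<open>A\<close> as a Hopf algebra in its own right.  All structure maps are restricted; only
  the comultiplication has to be adapted, because its values are now cosets in the free module on
  \<open>A \<times> A\<close>: it is the corestriction along the injective map \<open>A \<otimes> A \<rightarrow> H \<otimes> H\<close>.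
\<close>

definition restrict_hopf ::
  "('a, 'r) ring_scheme \<Rightarrow> ('a, 'h, 's) hopf_scheme \<Rightarrow> 'h set \<Rightarrow> ('a, 'h, 's) hopf_scheme" where
  "restrict_hopf K H A =
    (let A' = H\<lparr>carrier := A\<rparr> in
      A' \<lparr> comult := (\<lambda>x. THE u. u \<in> carrier (tensor_module K A' A') \<and>
                              tensor_map K H H id id u = comult H x) \<rparr>)"

definition finite_dimensional ::
  "('a, 'r) ring_scheme \<Rightarrow> ('a, 'm, 's) module_scheme \<Rightarrow> bool" where
  "finite_dimensional K M \<longleftrightarrow>
    (\<exists>B. finite B \<and> B \<subseteq> carrier M \<and> module_span K M B = carrier M)"

definition left_integrals :: "('a, 'h, 's) hopf_scheme \<Rightarrow> 'h set" where
  "left_integrals H =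
    {h \<in> carrier H. \<forall>y\<in>carrier H. y \<otimes>\<^bsub>H\<^esub> h = counit H y \<odot>\<^bsub>H\<^esub> h}"

definition right_integrals :: "('a, 'h, 's) hopf_scheme \<Rightarrow> 'h set" where
  "right_integrals H =
    {h \<in> carrier H. \<forall>y\<in>carrier H. h \<otimes>\<^bsub>H\<^esub> y = counit H y \<odot>\<^bsub>H\<^esub> h}"

definition unimodular :: "('a, 'h, 's) hopf_scheme \<Rightarrow> bool" where
  "unimodular H \<longleftrightarrow> left_integrals H = right_integrals H"

definition involutive :: "('a, 'h, 's) hopf_scheme \<Rightarrow> bool" where
  "involutive H \<longleftrightarrow> (\<forall>h\<in>carrier H. antipode H (antipode H h) = h)"


section \<open>Locally Frobenius Hopf algebras\<close>

text \<open>The admissible index posets \<open>(\<Lambda>, \<preceq>, \<lambda>\<^sub>0)\<close>, with \<open>\<preceq>\<close> given as a relation on \<open>\<Lambda>\<close>.\<close>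

definition index_shape :: "'i set \<Rightarrow> 'i rel \<Rightarrow> 'i \<Rightarrow> bool" where
  "index_shape \<Lambda> r l0 \<longleftrightarrow>
    infinite \<Lambda> \<and> partial_order_on \<Lambda> r \<and>
    (\<forall>x\<in>\<Lambda>. \<forall>y\<in>\<Lambda>. \<exists>z\<in>\<Lambda>. (x, z) \<in> r \<and> (y, z) \<in> r) \<and>
    l0 \<in> \<Lambda> \<and> (\<forall>x\<in>\<Lambda>. (l0, x) \<in> r) \<and>
    (\<forall>\<mu>\<in>\<Lambda>. (\<forall>x\<in>\<Lambda>. (\<mu>, x) \<in> r) \<longrightarrow> \<mu> = l0) \<and>
    (\<forall>x\<in>\<Lambda>. \<exists>y\<in>\<Lambda>. (x, y) \<in> r \<and> x \<noteq> y)"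

definition locally_Frobenius_system ::
  "('a, 'r) ring_scheme \<Rightarrow> ('a, 'h, 's) hopf_scheme \<Rightarrow>
    'i set \<Rightarrow> 'i rel \<Rightarrow> 'i \<Rightarrow> ('i \<Rightarrow> 'h set) \<Rightarrow> bool" where
  "locally_Frobenius_system K H \<Lambda> r l0 F \<longleftrightarrow>
    index_shape \<Lambda> r l0 \<and>
    (\<forall>x\<in>\<Lambda>. sub_hopf_algebra K H (F x) \<and>
      finite_dimensional K (restrict_hopf K H (F x)) \<and>
      involutive (restrict_hopf K H (F x)) \<and>
      unimodular (restrict_hopf K H (F x))) \<and>
    (\<forall>x\<in>\<Lambda>. \<forall>y\<in>\<Lambda>. (x, y) \<in> r \<and> x \<noteq> y \<longrightarrow> F x \<subset> F y) \<and>
    F l0 = {c \<odot>\<^bsub>H\<^esub> \<one>\<^bsub>H\<^esub> | c. c \<in> carrier K} \<and>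
    carrier H = (\<Union>x\<in>\<Lambda>. F x)"

text \<open>
  HOL cannot quantify existentially over types, so the index set is taken inside the type of subsets
  of \<open>H\<close>, with an arbitrary order and an arbitrary indexing map.  By
  \<open>locally_Frobenius_systemD\<close> below this is no restriction.
\<close>

definition locally_Frobenius_hopf_algebra ::
  "('a, 'r) ring_scheme \<Rightarrow> ('a, 'h, 's) hopf_scheme \<Rightarrow> bool" where
  "locally_Frobenius_hopf_algebra K H \<longleftrightarrow>
    hopf_algebra K H \<and>
    (\<exists>(\<Lambda> :: 'h set set) r l0 F. locally_Frobenius_system K H \<Lambda> r l0 F)"

lemma locally_Frobenius_systemD:
  fixes \<Lambda> :: "'i set" and F :: "'i \<Rightarrow> 'h set"
  assumes "hopf_algebra K H" and sys: "locally_Frobenius_system K H \<Lambda> r l0 F"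
  shows "locally_Frobenius_hopf_algebra K H"
proof -
  define \<Lambda>' where "\<Lambda>' = F ` \<Lambda>"
  define r' where "r' = {(A, B). A \<in> \<Lambda>' \<and> B \<in> \<Lambda>' \<and> A \<subseteq> B}"
  note sys' = sys[unfolded locally_Frobenius_system_def]
  note shape = sys'[THEN conjunct1, unfolded index_shape_def]
  have mono: "F x \<subset> F y" if "x \<in> \<Lambda>" "y \<in> \<Lambda>" "(x, y) \<in> r" "x \<noteq> y" for x y
    using sys'[THEN conjunct2, THEN conjunct2, THEN conjunct1] that by blast
  have le: "F x \<subseteq> F y" if "x \<in> \<Lambda>" "y \<in> \<Lambda>" "(x, y) \<in> r" for x y
    using mono[OF that] by blast
  have bot: "l0 \<in> \<Lambda>" and least: "\<forall>x\<in>\<Lambda>. (l0, x) \<in> r"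
    and up: "\<forall>x\<in>\<Lambda>. \<forall>y\<in>\<Lambda>. \<exists>z\<in>\<Lambda>. (x, z) \<in> r \<and> (y, z) \<in> r"
    and ex: "\<forall>x\<in>\<Lambda>. \<exists>y\<in>\<Lambda>. (x, y) \<in> r \<and> x \<noteq> y"
    using shape by iprover+
  have bigger: "\<exists>B\<in>\<Lambda>'. A \<subset> B" if A: "A \<in> \<Lambda>'" for A
  proof -
    obtain x where x: "x \<in> \<Lambda>" "A = F x" using A unfolding \<Lambda>'_def by blast
    then obtain y where y: "y \<in> \<Lambda>" "(x, y) \<in> r" "x \<noteq> y" using ex by blast
    have "F y \<in> \<Lambda>'" using y(1) unfolding \<Lambda>'_def by (rule imageI)
    moreover have "A \<subset> F y" using mono[OF x(1) y] x(2) by simp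
    ultimately show ?thesis by (rule bexI[rotated])
  qed
  have bot': "F l0 \<in> \<Lambda>'" using bot unfolding \<Lambda>'_def by blast
  have least': "F l0 \<subseteq> A" if A: "A \<in> \<Lambda>'" for A
  proof -
    obtain x where "x \<in> \<Lambda>" "A = F x" using A unfolding \<Lambda>'_def by (rule imageE)
    then show ?thesis using le[OF bot] least by simp
  qed
  have inf': "infinite \<Lambda>'"
  proof
    assume fin: "finite \<Lambda>'"
    have "\<Lambda>' \<noteq> {}" using bot' by (rule ex_in_conv[THEN iffD1, OF exI])
    from finite_has_maximal[OF fin this]
    obtain A where A: "A \<in> \<Lambda>'" "\<forall>B\<in>\<Lambda>'. A \<subseteq> B \<longrightarrow> A = B" by (rule bexE)
    from bigger[OF A(1)] obtain B where "B \<in> \<Lambda>'" "A \<subset> B" by (rule bexE)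
    then show False using A(2) by blast
  qed
  have order': "partial_order_on \<Lambda>' r'"
    unfolding partial_order_on_def preorder_on_def
  proof (intro conjI)
    show "r' \<subseteq> \<Lambda>' \<times> \<Lambda>'" unfolding r'_def by blast
    show "refl_on \<Lambda>' r'" unfolding r'_def by (rule refl_onI) blast
    show "trans r'" unfolding r'_def by (rule transI) blast
    show "antisym r'" unfolding r'_def by (rule antisymI) blast
  qed
  have up': "\<exists>C\<in>\<Lambda>'. (A, C) \<in> r' \<and> (B, C) \<in> r'" if AB: "A \<in> \<Lambda>'" "B \<in> \<Lambda>'" for A B
  proof -
    obtain x y where xy: "x \<in> \<Lambda>" "A = F x" "y \<in> \<Lambda>" "B = F y"
      using AB unfolding \<Lambda>'_def by blast
    then obtain z where z: "z \<in> \<Lambda>" "(x, z) \<in> r" "(y, z) \<in> r" using up by blast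
    have "F z \<in> \<Lambda>'" using z(1) unfolding \<Lambda>'_def by (rule imageI)
    moreover have "A \<subseteq> F z" "B \<subseteq> F z" using xy z le by simp_all
    ultimately show ?thesis using AB by (intro bexI[of _ "F z"]) (simp_all add: r'_def)
  qed
  have bigger': "\<exists>B\<in>\<Lambda>'. (A, B) \<in> r' \<and> A \<noteq> B" if "A \<in> \<Lambda>'" for A
    using bigger[OF that] that unfolding r'_def by blast
  have unique': "A = F l0" if "A \<in> \<Lambda>'" "\<forall>B\<in>\<Lambda>'. (A, B) \<in> r'" for A
  proof (rule antisym)
    show "A \<subseteq> F l0" using that(2) bot' unfolding r'_def by blast
  qed (rule least'[OF that(1)])
  have least'': "\<forall>A\<in>\<Lambda>'. (F l0, A) \<in> r'"
    using bot' least' unfolding r'_def by blast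
  have "index_shape \<Lambda>' r' (F l0)"
    unfolding index_shape_def
    by (intro conjI inf' order' bot' least'' ballI impI up' bigger') (assumption | rule unique')+
  moreover have "\<forall>A\<in>\<Lambda>'. sub_hopf_algebra K H (id A) \<and>
      finite_dimensional K (restrict_hopf K H (id A)) \<and>
      involutive (restrict_hopf K H (id A)) \<and>
      unimodular (restrict_hopf K H (id A))"
    using sys'[THEN conjunct2, THEN conjunct1] unfolding \<Lambda>'_def ball_simps(9) id_apply .
  moreover have "\<forall>A\<in>\<Lambda>'. \<forall>B\<in>\<Lambda>'. (A, B) \<in> r' \<and> A \<noteq> B \<longrightarrow> id A \<subset> id B"
    unfolding r'_def id_apply by blast
  moreover have "id (F l0) = {c \<odot>\<^bsub>H\<^esub> \<one>\<^bsub>H\<^esub> | c. c \<in> carrier K}"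
    using sys'[THEN conjunct2, THEN conjunct2, THEN conjunct2, THEN conjunct1]
    unfolding id_apply .
  moreover have "carrier H = (\<Union>A\<in>\<Lambda>'. id A)"
    using sys'[THEN conjunct2, THEN conjunct2, THEN conjunct2, THEN conjunct2]
    unfolding \<Lambda>'_def image_image id_apply .
  ultimately have "locally_Frobenius_system K H \<Lambda>' r' (F l0) id"
    unfolding locally_Frobenius_system_def by (intro conjI)
  then show ?thesis
    unfolding locally_Frobenius_hopf_algebra_def using assms(1) by blast
qed


section \<open>Locally finite groups and group algebras\<close>

locale locally_finite_group = group G for G (structure) +
  assumes countable_carrier: "countable (carrier G)"
    and finite_subset_in_finite_subgroup:
      "\<lbrakk>finite S; S \<subseteq> carrier G\<rbrakk> \<Longrightarrow> \<exists>H. subgroup H G \<and> finite H \<and> S \<subseteq> H"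

definition group_ring ::
  "('a, 'r) ring_scheme \<Rightarrow> ('g, 'm) monoid_scheme \<Rightarrow> ('a, 'g \<Rightarrow> 'a) module" where
  "group_ring K G = (free_module K (carrier G))
    \<lparr> monoid.mult := (\<lambda>f f' x. \<Oplus>\<^bsub>K\<^esub>p\<in>{(y, z). f y \<noteq> \<zero>\<^bsub>K\<^esub> \<and> f' z \<noteq> \<zero>\<^bsub>K\<^esub> \<and> y \<otimes>\<^bsub>G\<^esub> z = x}.
                  f (fst p) \<otimes>\<^bsub>K\<^esub> f' (snd p)),
      one := basis_vec K \<one>\<^bsub>G\<^esub> \<rparr>"

text \<open>
  The standard Hopf structure is the linear extension of \<open>g \<mapsto> g \<otimes> g\<close>, \<open>g \<mapsto> 1\<close> and \<open>g \<mapsto> g\<^sup>-\<^sup>1\<close>.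
\<close>

definition group_algebra ::
  "('a, 'r) ring_scheme \<Rightarrow> ('g, 'm) monoid_scheme \<Rightarrow> ('a, 'g \<Rightarrow> 'a) hopf" where
  "group_algebra K G =
    (let A = group_ring K G in
      module.extend A
        \<lparr> comult = lin_ext K (tensor_module K A A)
                    (\<lambda>g. pure_tensor K A A (basis_vec K g) (basis_vec K g)),
          counit = (\<lambda>f. \<Oplus>\<^bsub>K\<^esub>g\<in>{g. f g \<noteq> \<zero>\<^bsub>K\<^esub>}. f g),
          antipode = lin_ext K A (\<lambda>g. basis_vec K (inv\<^bsub>G\<^esub> g)) \<rparr>)"

end

theory Submission
  imports Defs
begin

text \<open>
  The index set consists of the finite subgroups of \<open>G\<close>, ordered by inclusion, and \<open>S\<close> is sent to \<open>kS\<close>,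
  the functions in \<open>kG\<close> supported on \<open>S\<close>.  By local finiteness these subalgebras are directed with union
  \<open>kG\<close>, and since \<open>G\<close> is infinite no finite subgroup is maximal.  The antipode of \<open>kG\<close> inverts group
  elements, so it is an involution; in \<open>kS\<close> the left and the right integrals are both the constant
  functions on \<open>S\<close>.  All Hopf algebra axioms are equations between linear maps on \<open>kG\<close>, so by the
  universal property of the tensor product they need to be checked only on group elements, where the
  comultiplication is diagonal.
\<close>

section \<open>Linear maps and spans\<close>

text \<open>Tensors are literal cosets of finitely supported functions, and
  \<open>tensor_lift\<close> extracts a value with \<open>the_elem\<close>, so nothing about
  \<open>comult\<close> can be computed before that image is known to be a singleton. Once
  \<open>tensor_lift\<close> is linear with the expected value on pure tensors, the elements of
  cosets are not inspected again: both sides of an identity are exhibited as linear maps, often as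
  composites, and compared on a spanning set. Identities in several variables are treated one
  variable at a time, which is why so many lemmas only assert linearity of some expression. For the
  integrals no averaging is used, so the characteristic of the field may divide the order of
  \<open>S\<close>. A left integral \<open>h\<close> satisfies g h = h for each g in
  \<open>S\<close>, because the counit of g is 1; this is invariance under translation, and
  evaluation at g gives h(g) = h(1). The computation on the other side leads to the same
  set.\<close>

lemma linear_mapI:
  assumes "\<And>x. x \<in> carrier M \<Longrightarrow> f x \<in> carrier N"
    and "\<And>x y. \<lbrakk>x \<in> carrier M; y \<in> carrier M\<rbrakk> \<Longrightarrow> f (x \<oplus>\<^bsub>M\<^esub> y) = f x \<oplus>\<^bsub>N\<^esub> f y"
    and "\<And>c x. \<lbrakk>c \<in> carrier K; x \<in> carrier M\<rbrakk> \<Longrightarrow> f (c \<odot>\<^bsub>M\<^esub> x) = c \<odot>\<^bsub>N\<^esub> f x"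
  shows "linear_map K M N f"
  using assms by (auto simp: linear_map_def)

lemma linear_mapD:
  assumes "linear_map K M N f"
  shows linear_map_closed: "x \<in> carrier M \<Longrightarrow> f x \<in> carrier N"
    and linear_map_add: "\<lbrakk>x \<in> carrier M; y \<in> carrier M\<rbrakk> \<Longrightarrow> f (x \<oplus>\<^bsub>M\<^esub> y) = f x \<oplus>\<^bsub>N\<^esub> f y"
    and linear_map_smult: "\<lbrakk>c \<in> carrier K; x \<in> carrier M\<rbrakk> \<Longrightarrow> f (c \<odot>\<^bsub>M\<^esub> x) = c \<odot>\<^bsub>N\<^esub> f x"
  using assms by (auto simp: linear_map_def)

lemma linear_map_id: "linear_map K M M id"
  by (rule linear_mapI) auto

lemma linear_map_compose:
  assumes "linear_map K L M f" "linear_map K M N g"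
  shows "linear_map K L N (\<lambda>x. g (f x))"
  using linear_mapD[OF assms(1)] linear_mapD[OF assms(2)] by (intro linear_mapI) auto

text \<open>The module hypothesis keeps sums and multiples inside the carrier, so that the agreement
  of \<open>f\<close> and \<open>g\<close> may be applied to them too.\<close>

lemma linear_map_cong:
  assumes f: "linear_map K M N f" and eq: "\<And>x. x \<in> carrier M \<Longrightarrow> f x = g x" and M: "module K M"
  shows "linear_map K M N g"
proof -
  interpret module K M by (rule M)
  show ?thesis
    using linear_mapD[OF f] by (intro linear_mapI) (simp_all add: eq[symmetric])
qed

lemma linear_map_plus:
  assumes N: "module K N" and f: "linear_map K M N f" and g: "linear_map K M N g"
  shows "linear_map K M N (\<lambda>x. f x \<oplus>\<^bsub>N\<^esub> g x)"
proof -
  interpret N: module K N by (rule N)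
  note fD = linear_mapD[OF f] and gD = linear_mapD[OF g]
  show ?thesis
    by (intro linear_mapI) (simp_all add: fD gD N.smult_r_distr N.M.a_ac)
qed

lemma linear_map_scale:
  assumes N: "module K N" and f: "linear_map K M N f" and c: "c \<in> carrier K"
  shows "linear_map K M N (\<lambda>x. c \<odot>\<^bsub>N\<^esub> f x)"
proof -
  interpret N: module K N by (rule N)
  note fD = linear_mapD[OF f]
  \<comment> \<open>Here the commutativity of the scalars enters: \<open>c\<close> and
    \<open>d\<close> change places.\<close>
  have "c \<odot>\<^bsub>N\<^esub> (d \<odot>\<^bsub>N\<^esub> f x) = d \<odot>\<^bsub>N\<^esub> (c \<odot>\<^bsub>N\<^esub> f x)"
    if "d \<in> carrier K" "x \<in> carrier M" for d x
    using that c fD(1) by (metis N.smult_assoc1 N.R.m_comm)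
  then show ?thesis
    using c by (intro linear_mapI) (simp_all add: fD N.smult_r_distr)
qed

text \<open>The functional \<open>f\<close> takes values in the ring \<open>K\<close>, whose record
  has no \<open>smult\<close> field; hence its linearity is spelled out instead of being stated with
  \<open>linear_map\<close>.\<close>

lemma linear_map_smult_const:
  assumes N: "module K N" and n: "n \<in> carrier N" and f: "f \<in> carrier M \<rightarrow> carrier K"
    and add: "\<And>x y. \<lbrakk>x \<in> carrier M; y \<in> carrier M\<rbrakk> \<Longrightarrow> f (x \<oplus>\<^bsub>M\<^esub> y) = f x \<oplus>\<^bsub>K\<^esub> f y"
    and smult: "\<And>c x. \<lbrakk>c \<in> carrier K; x \<in> carrier M\<rbrakk> \<Longrightarrow> f (c \<odot>\<^bsub>M\<^esub> x) = c \<otimes>\<^bsub>K\<^esub> f x"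
  shows "linear_map K M N (\<lambda>x. f x \<odot>\<^bsub>N\<^esub> n)"
proof -
  interpret N: module K N by (rule N)
  have f': "f x \<in> carrier K" if "x \<in> carrier M" for x
    using f that by blast
  show ?thesis
    using n by (intro linear_mapI) (simp_all add: add smult f' N.smult_l_distr N.smult_assoc1)
qed

lemma linear_map_zero:
  assumes M: "module K M" and N: "module K N" and f: "linear_map K M N f"
  shows "f \<zero>\<^bsub>M\<^esub> = \<zero>\<^bsub>N\<^esub>"
proof -
  interpret M: module K M by (rule M)
  interpret N: module K N by (rule N)
  have "f (\<zero>\<^bsub>K\<^esub> \<odot>\<^bsub>M\<^esub> \<zero>\<^bsub>M\<^esub>) = \<zero>\<^bsub>K\<^esub> \<odot>\<^bsub>N\<^esub> f \<zero>\<^bsub>M\<^esub>"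
    by (rule linear_map_smult[OF f]) simp_all
  then show ?thesis
    using linear_map_closed[OF f] by simp
qed

text \<open>Turns negation into a scalar multiple, so that it comes for free both for linear maps
  and for closure of submodules.\<close>

lemma (in module) uminus_conv_smult:
  "x \<in> carrier M \<Longrightarrow> \<ominus>\<^bsub>M\<^esub> x = (\<ominus> \<one>) \<odot>\<^bsub>M\<^esub> x"
  by (simp add: smult_l_minus)

lemma linear_map_minus:
  assumes M: "module K M" and N: "module K N" and f: "linear_map K M N f"
    and "x \<in> carrier M" "y \<in> carrier M"
  shows "f (x \<ominus>\<^bsub>M\<^esub> y) = f x \<ominus>\<^bsub>N\<^esub> f y"
proof -
  interpret M: module K M by (rule M)
  interpret N: module K N by (rule N)
  show ?thesis
    using assms(4,5) linear_mapD[OF f]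
    by (simp add: a_minus_def M.uminus_conv_smult N.uminus_conv_smult)
qed

lemma (in module) submoduleI':
  assumes subset: "H \<subseteq> carrier M"
    and zero: "\<zero>\<^bsub>M\<^esub> \<in> H"
    and add: "\<And>a b. \<lbrakk>a \<in> H; b \<in> H\<rbrakk> \<Longrightarrow> a \<oplus>\<^bsub>M\<^esub> b \<in> H"
    and smult: "\<And>a x. \<lbrakk>a \<in> carrier R; x \<in> H\<rbrakk> \<Longrightarrow> a \<odot>\<^bsub>M\<^esub> x \<in> H"
  shows "submodule H R M"
proof (rule submoduleI[OF subset zero _ add smult])
  fix a assume "a \<in> H"
  then show "\<ominus>\<^bsub>M\<^esub> a \<in> H"
    using smult[of "\<ominus> \<one>" a] subset by (auto simp: uminus_conv_smult)
qed

lemma (in module) submodule_zero: "submodule H R M \<Longrightarrow> \<zero>\<^bsub>M\<^esub> \<in> H"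
  using submodule.axioms(1) subgroup.one_closed by fastforce

text \<open>\<open>group_algebra\<close>, its restrictions and \<open>free_module\<close> are
  different records with the same four module fields; this carries submodules and spans between
  them.\<close>

lemma submodule_cong:
  assumes "carrier M = carrier M'" "add M = add M'" "zero M = zero M'" "smult M = smult M'"
  shows "submodule N K M \<longleftrightarrow> submodule N K M'"
  using assms
  by (simp add: submodule_def submodule_axioms_def subgroup_def m_inv_def)

lemma module_span_cong:
  assumes "carrier M = carrier M'" "add M = add M'" "zero M = zero M'" "smult M = smult M'"
  shows "module_span K M S = module_span K M' S"
  unfolding module_span_def by (simp add: submodule_cong[OF assms])

lemma module_span_superset: "S \<subseteq> module_span K M S"
  by (auto simp: module_span_def)

lemma module_span_least: "\<lbrakk>submodule N K M; S \<subseteq> N\<rbrakk> \<Longrightarrow> module_span K M S \<subseteq> N"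
  by (auto simp: module_span_def)

lemma (in module) module_span_submodule:
  assumes "S \<subseteq> carrier M"
  shows "submodule (module_span R M S) R M"
proof (rule submoduleI')
  show "module_span R M S \<subseteq> carrier M"
    by (rule module_span_least[OF carrier_is_submodule assms])
qed (auto simp: module_span_def submodule_zero submoduleE(4,5))

lemma submodule_linear_vimage:
  assumes M: "module K M" and N: "module K N" and f: "linear_map K M N f"
    and V: "submodule V K N"
  shows "submodule {x \<in> carrier M. f x \<in> V} K M"
proof -
  interpret M: module K M by (rule M)
  interpret N: module K N by (rule N)
  show ?thesis
    using linear_mapD[OF f] linear_map_zero[OF M N f] N.submodule_zero[OF V] N.submoduleE(4,5)[OF V]
    by (intro M.submoduleI') auto
qed

text \<open>Induction over a span: the preimage of \<open>V\<close> is a submodule, so it contains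
  the span of \<open>S\<close> as soon as it contains \<open>S\<close>.\<close>

lemma linear_map_span_subset:
  assumes "module K M" "module K N" "linear_map K M N f" "submodule V K N"
    and "S \<subseteq> carrier M" "f ` S \<subseteq> V" "x \<in> module_span K M S"
  shows "f x \<in> V"
  using module_span_least[OF submodule_linear_vimage[OF assms(1-4)], of S] assms(5-7) by auto

text \<open>The set where \<open>f\<close> and \<open>g\<close> agree is a submodule; containing a
  spanning set, it is everything.\<close>

lemma linear_map_eqI:
  assumes M: "module K M" and N: "module K N"
    and f: "linear_map K M N f" and g: "linear_map K M N g"
    and span: "module_span K M S = carrier M" and eq: "\<And>x. x \<in> S \<Longrightarrow> f x = g x"
    and x: "x \<in> carrier M"
  shows "f x = g x"
proof -
  interpret M: module K M by (rule M)
  interpret N: module K N by (rule N)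
  have "submodule {x \<in> carrier M. f x = g x} K M"
    using linear_mapD[OF f] linear_mapD[OF g] linear_map_zero[OF M N f] linear_map_zero[OF M N g]
    by (intro M.submoduleI') auto
  from module_span_least[OF this, of S] module_span_superset[of S K M] span eq x show ?thesis
    by auto
qed

section \<open>Free modules\<close>

lemma free_module_simps [simp]:
  "zero (free_module K U) = (\<lambda>x. \<zero>\<^bsub>K\<^esub>)"
  "add (free_module K U) = (\<lambda>f g x. f x \<oplus>\<^bsub>K\<^esub> g x)"
  "smult (free_module K U) = (\<lambda>c f x. c \<otimes>\<^bsub>K\<^esub> f x)"
  by (simp_all add: free_module_def)

lemma free_module_carrier:
  "f \<in> carrier (free_module K U) \<longleftrightarrow>
    (\<forall>x. f x \<in> carrier K) \<and> finite {x. f x \<noteq> \<zero>\<^bsub>K\<^esub>} \<and> (\<forall>x. x \<notin> U \<longrightarrow> f x = \<zero>\<^bsub>K\<^esub>)"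
  by (auto simp: free_module_def)

lemma free_module_carrierD:
  assumes "f \<in> carrier (free_module K U)"
  shows "f x \<in> carrier K" "finite {x. f x \<noteq> \<zero>\<^bsub>K\<^esub>}" "x \<notin> U \<Longrightarrow> f x = \<zero>\<^bsub>K\<^esub>"
    "{x. f x \<noteq> \<zero>\<^bsub>K\<^esub>} \<subseteq> U"
  using assms by (auto simp: free_module_carrier)

lemma module_free_module:
  assumes "cring K"
  shows "module K (free_module K U)"
proof -
  interpret cring K by (rule assms)
  \<comment> \<open>All axioms hold pointwise; the cases singled out are those in which a new
    function is formed and its support must be shown finite.\<close>
  show ?thesis
  proof (rule moduleI[OF assms abelian_groupI], goal_cases)
    case (1 f g)
    have "{x. f x \<oplus>\<^bsub>K\<^esub> g x \<noteq> \<zero>\<^bsub>K\<^esub>} \<subseteq> {x. f x \<noteq> \<zero>\<^bsub>K\<^esub>} \<union> {x. g x \<noteq> \<zero>\<^bsub>K\<^esub>}"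
      by auto
    from finite_subset[OF this] 1 show ?case
      by (auto simp: free_module_carrier)
  next
    case (6 f)
    have "{x. \<ominus>\<^bsub>K\<^esub> f x \<noteq> \<zero>\<^bsub>K\<^esub>} \<subseteq> {x. f x \<noteq> \<zero>\<^bsub>K\<^esub>}"
      by auto
    from finite_subset[OF this] 6
    have "(\<lambda>x. \<ominus>\<^bsub>K\<^esub> f x) \<in> carrier (free_module K U)"
      by (auto simp: free_module_carrier)
    moreover have "(\<lambda>x. \<ominus>\<^bsub>K\<^esub> f x) \<oplus>\<^bsub>free_module K U\<^esub> f = \<zero>\<^bsub>free_module K U\<^esub>"
      using 6 by (auto simp: free_module_carrier l_neg)
    ultimately show ?case by blast
  next
    case (7 a f)
    have "{x. a \<otimes>\<^bsub>K\<^esub> f x \<noteq> \<zero>\<^bsub>K\<^esub>} \<subseteq> {x. f x \<noteq> \<zero>\<^bsub>K\<^esub>}"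
      using 7 by auto
    from finite_subset[OF this] 7 show ?case
      by (auto simp: free_module_carrier)
  qed (auto simp: free_module_carrier a_ac l_distr r_distr m_assoc)
qed

lemma basis_vec_closed:
  assumes "cring K" "x \<in> U"
  shows "basis_vec K x \<in> carrier (free_module K U)"
proof -
  interpret cring K by (rule assms)
  have "{y. basis_vec K x y \<noteq> \<zero>\<^bsub>K\<^esub>} \<subseteq> {x}"
    by (auto simp: basis_vec_def)
  from finite_subset[OF this] show ?thesis
    using assms(2) by (auto simp: free_module_carrier basis_vec_def)
qed

lemma module_span_basis_vec:
  assumes K: "cring K"
  shows "module_span K (free_module K U) (basis_vec K ` U) = carrier (free_module K U)"
proof
  interpret K: cring K by (rule K)
  let ?F = "free_module K U" and ?N = "module_span K (free_module K U) (basis_vec K ` U)"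
  interpret module K ?F by (rule module_free_module[OF K])
  have sub: "basis_vec K ` U \<subseteq> carrier ?F"
    using basis_vec_closed[OF K] by auto
  show "?N \<subseteq> carrier ?F"
    by (rule module_span_least[OF carrier_is_submodule sub])
  note N = module_span_submodule[OF sub]
  \<comment> \<open>The induction is over a finite superset of the support, not the support itself:
    the added point \<open>a\<close> may then lie outside \<open>U\<close>, where \<open>f\<close>
    vanishes and the point is simply dropped.\<close>
  have "f \<in> ?N" if "finite A" "f \<in> carrier ?F" "{x. f x \<noteq> \<zero>\<^bsub>K\<^esub>} \<subseteq> A" for A f
    using that
  proof (induction A arbitrary: f)
    case empty
    then have "f = \<zero>\<^bsub>?F\<^esub>" by auto
    then show ?case using submodule_zero[OF N] by simp
  next
    case (insert a A)
    show ?case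
    proof (cases "a \<in> U")
      case False
      then have "f a = \<zero>\<^bsub>K\<^esub>" using insert.prems(1) by (auto simp: free_module_carrier)
      then show ?thesis using insert.prems insert.IH[of f] by blast
    next
      case True
      \<comment> \<open>\<open>f\<close> with its coordinate at \<open>a\<close> erased; that
        coordinate is put back as a multiple of the basis vector.\<close>
      let ?g = "f(a := \<zero>\<^bsub>K\<^esub>)"
      have "{x. ?g x \<noteq> \<zero>\<^bsub>K\<^esub>} \<subseteq> {x. f x \<noteq> \<zero>\<^bsub>K\<^esub>}" by auto
      from finite_subset[OF this] have "?g \<in> carrier ?F"
        using insert.prems(1) by (auto simp: free_module_carrier)
      moreover have "{x. ?g x \<noteq> \<zero>\<^bsub>K\<^esub>} \<subseteq> A" using insert.prems(2) by auto
      ultimately have "?g \<in> ?N" by (rule insert.IH)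
      moreover have "f a \<odot>\<^bsub>?F\<^esub> basis_vec K a \<in> ?N"
        using submoduleE(4)[OF N] True insert.prems(1) module_span_superset
        by (metis free_module_carrierD(1) image_subset_iff)
      ultimately have "?g \<oplus>\<^bsub>?F\<^esub> f a \<odot>\<^bsub>?F\<^esub> basis_vec K a \<in> ?N"
        by (rule submoduleE(5)[OF N])
      also have "?g \<oplus>\<^bsub>?F\<^esub> f a \<odot>\<^bsub>?F\<^esub> basis_vec K a = f"
        using insert.prems(1) by (auto simp: basis_vec_def free_module_carrier)
      finally show ?thesis .
    qed
  qed
  then show "carrier ?F \<subseteq> ?N"
    using free_module_carrierD(2) by blast
qed

text \<open>\<open>lin_ext\<close> sums over the exact support, which changes from function to
  function; padding with zero terms makes several of these sums comparable.\<close>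

lemma lin_ext_superset:
  assumes P: "module K P" and \<phi>: "\<phi> \<in> U \<rightarrow> carrier P" and f: "f \<in> carrier (free_module K U)"
    and A: "finite A" "{x. f x \<noteq> \<zero>\<^bsub>K\<^esub>} \<subseteq> A" "A \<subseteq> U"
  shows "lin_ext K P \<phi> f = (\<Oplus>\<^bsub>P\<^esub>x\<in>A. f x \<odot>\<^bsub>P\<^esub> \<phi> x)"
proof -
  interpret P: module K P by (rule P)
  have cl: "\<phi> x \<in> carrier P" if "x \<in> A" for x using \<phi> A(3) that by blast
  show ?thesis
    unfolding lin_ext_def
    using A free_module_carrierD(1)[OF f]
    by (intro P.M.add.finprod_mono_neutral_cong_left) (auto simp: cl)
qed

lemma lin_ext_linear:
  assumes P: "module K P" and \<phi>: "\<phi> \<in> U \<rightarrow> carrier P"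
  shows "linear_map K (free_module K U) P (lin_ext K P \<phi>)"
proof -
  interpret P: module K P by (rule P)
  let ?F = "free_module K U"
  interpret F: module K ?F by (rule module_free_module) unfold_locales
  note D = free_module_carrierD
  have \<phi>': "x \<in> U \<Longrightarrow> \<phi> x \<in> carrier P" for x using \<phi> by blast
  show ?thesis
  proof (rule linear_mapI)
    fix f assume f: "f \<in> carrier ?F"
    show "lin_ext K P \<phi> f \<in> carrier P"
      unfolding lin_ext_def using D[OF f] \<phi>' by (intro P.M.finsum_closed) auto
    fix g assume g: "g \<in> carrier ?F"
    \<comment> \<open>A common index set for \<open>f\<close>, \<open>g\<close> and their sum, whose
      support may be smaller because of cancellation.\<close>
    define A where "A = {x. f x \<noteq> \<zero>\<^bsub>K\<^esub>} \<union> {x. g x \<noteq> \<zero>\<^bsub>K\<^esub>}"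
    have A: "finite A" "A \<subseteq> U" unfolding A_def using D(2,4)[OF f] D(2,4)[OF g] by auto
    have cl: "\<phi> x \<in> carrier P" if "x \<in> A" for x using \<phi> A(2) that by blast
    have "lin_ext K P \<phi> (f \<oplus>\<^bsub>?F\<^esub> g) = (\<Oplus>\<^bsub>P\<^esub>x\<in>A. (f \<oplus>\<^bsub>?F\<^esub> g) x \<odot>\<^bsub>P\<^esub> \<phi> x)"
      using F.M.a_closed[OF f g] A by (intro lin_ext_superset[OF P \<phi>]) (auto simp: A_def)
    also have "\<dots> = (\<Oplus>\<^bsub>P\<^esub>x\<in>A. f x \<odot>\<^bsub>P\<^esub> \<phi> x \<oplus>\<^bsub>P\<^esub> g x \<odot>\<^bsub>P\<^esub> \<phi> x)"
      by (intro P.M.finsum_cong') (auto simp: D(1)[OF f] D(1)[OF g] cl P.smult_l_distr)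
    also have "\<dots> = (\<Oplus>\<^bsub>P\<^esub>x\<in>A. f x \<odot>\<^bsub>P\<^esub> \<phi> x) \<oplus>\<^bsub>P\<^esub> (\<Oplus>\<^bsub>P\<^esub>x\<in>A. g x \<odot>\<^bsub>P\<^esub> \<phi> x)"
      by (intro P.M.finsum_addf) (auto simp: D(1)[OF f] D(1)[OF g] cl)
    also have "(\<Oplus>\<^bsub>P\<^esub>x\<in>A. f x \<odot>\<^bsub>P\<^esub> \<phi> x) = lin_ext K P \<phi> f"
      using A by (intro lin_ext_superset[OF P \<phi> f, symmetric]) (auto simp: A_def)
    also have "(\<Oplus>\<^bsub>P\<^esub>x\<in>A. g x \<odot>\<^bsub>P\<^esub> \<phi> x) = lin_ext K P \<phi> g"
      using A by (intro lin_ext_superset[OF P \<phi> g, symmetric]) (auto simp: A_def)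
    finally show "lin_ext K P \<phi> (f \<oplus>\<^bsub>?F\<^esub> g) = lin_ext K P \<phi> f \<oplus>\<^bsub>P\<^esub> lin_ext K P \<phi> g" .
  next
    fix c f assume c: "c \<in> carrier K" and f: "f \<in> carrier ?F"
    let ?A = "{x. f x \<noteq> \<zero>\<^bsub>K\<^esub>}"
    \<comment> \<open>The support of the multiple may shrink, for instance when \<open>c\<close> is
      zero, so the sum is kept over the support of \<open>f\<close>.\<close>
    have "lin_ext K P \<phi> (c \<odot>\<^bsub>?F\<^esub> f) = (\<Oplus>\<^bsub>P\<^esub>x\<in>?A. (c \<odot>\<^bsub>?F\<^esub> f) x \<odot>\<^bsub>P\<^esub> \<phi> x)"
      using F.smult_closed[OF c f] D(2,4)[OF f] c
      by (intro lin_ext_superset[OF P \<phi>]) auto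
    also have "\<dots> = (\<Oplus>\<^bsub>P\<^esub>x\<in>?A. c \<odot>\<^bsub>P\<^esub> (f x \<odot>\<^bsub>P\<^esub> \<phi> x))"
      using D(4)[OF f] c by (intro P.M.finsum_cong') (auto simp: D(1)[OF f] \<phi>' P.smult_assoc1)
    also have "\<dots> = c \<odot>\<^bsub>P\<^esub> lin_ext K P \<phi> f"
      unfolding lin_ext_def
      using D(4)[OF f] c by (intro P.finsum_smult_ldistr[symmetric] D(2)[OF f]) (auto simp: D(1)[OF f] \<phi>')
    finally show "lin_ext K P \<phi> (c \<odot>\<^bsub>?F\<^esub> f) = c \<odot>\<^bsub>P\<^esub> lin_ext K P \<phi> f" .
  qed
qed

lemma lin_ext_basis_vec:
  assumes P: "module K P" and \<phi>: "\<phi> \<in> U \<rightarrow> carrier P" and x: "x \<in> U"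
  shows "lin_ext K P \<phi> (basis_vec K x) = \<phi> x"
proof -
  interpret P: module K P by (rule P)
  have "\<phi> x \<in> carrier P" using \<phi> x by blast
  moreover have "lin_ext K P \<phi> (basis_vec K x) = (\<Oplus>\<^bsub>P\<^esub>y\<in>{x}. basis_vec K x y \<odot>\<^bsub>P\<^esub> \<phi> y)"
    using x P.R.is_cring by (intro lin_ext_superset[OF P \<phi>] basis_vec_closed) (auto simp: basis_vec_def)
  ultimately show ?thesis by (simp add: basis_vec_def)
qed

section \<open>Quotients\<close>

context
  fixes K :: "('a, 'r) ring_scheme" and M :: "('a, 'm, 's) module_scheme" and N
  assumes M: "module K M" and N: "submodule N K M"
begin

interpretation M: module K M by (rule M)

interpretation N: abelian_subgroup N M
  using submodule.axioms(1)[OF N] M.abelian_group_axioms by (rule abelian_subgroupI3[OF additive_subgroupI])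

private abbreviation (input) "Q \<equiv> quotient_module K M N"

lemma quotient_module_carrier: "carrier (quotient_module K M N) = (\<lambda>x. N +>\<^bsub>M\<^esub> x) ` carrier M"
  by (auto simp: quotient_module_def A_RCOSETS_def')

lemma coset_eq_iff:
  assumes "x \<in> carrier M" "y \<in> carrier M"
  shows "N +>\<^bsub>M\<^esub> x = N +>\<^bsub>M\<^esub> y \<longleftrightarrow> x \<ominus>\<^bsub>M\<^esub> y \<in> N"
  using assms N.a_rcos_module[folded a_minus_def]
  by (metis N.a_rcos_self N.a_repr_independence' M.a_repr_independence N.a_subgroup)

lemma quotient_module_linear:
  "linear_map K M (quotient_module K M N) (\<lambda>x. N +>\<^bsub>M\<^esub> x)"
proof (rule linear_mapI)
  fix x y assume "x \<in> carrier M" "y \<in> carrier M"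
  then show "N +>\<^bsub>M\<^esub> (x \<oplus>\<^bsub>M\<^esub> y) = (N +>\<^bsub>M\<^esub> x) \<oplus>\<^bsub>Q\<^esub> (N +>\<^bsub>M\<^esub> y)"
    by (simp add: quotient_module_def N.a_rcos_sum)
next
  fix c x assume c: "c \<in> carrier K" and x: "x \<in> carrier M"
  \<comment> \<open>The scalar multiple of a coset is a union over all its representatives. Since
    c(y - x) stays in \<open>N\<close>, each representative contributes the same coset.\<close>
  have "N +>\<^bsub>M\<^esub> (c \<odot>\<^bsub>M\<^esub> y) = N +>\<^bsub>M\<^esub> (c \<odot>\<^bsub>M\<^esub> x)" if y: "y \<in> N +>\<^bsub>M\<^esub> x" for y
  proof -
    have yM: "y \<in> carrier M" using y x N.a_elemrcos_carrier M.abelian_group_axioms by blast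
    have "N +>\<^bsub>M\<^esub> y = N +>\<^bsub>M\<^esub> x" using N.a_repr_independence'[OF y x] by simp
    then have "y \<ominus>\<^bsub>M\<^esub> x \<in> N" using coset_eq_iff x yM by blast
    then have "c \<odot>\<^bsub>M\<^esub> (y \<ominus>\<^bsub>M\<^esub> x) \<in> N" using M.submoduleE(4)[OF N] c by blast
    also have "c \<odot>\<^bsub>M\<^esub> (y \<ominus>\<^bsub>M\<^esub> x) = c \<odot>\<^bsub>M\<^esub> y \<ominus>\<^bsub>M\<^esub> c \<odot>\<^bsub>M\<^esub> x"
      using c x yM by (simp add: a_minus_def M.smult_r_distr M.smult_r_minus)
    finally show ?thesis using coset_eq_iff c x yM by simp
  qed
  \<comment> \<open>The union of a constant family equals its member only over a non-empty index
    set; \<open>x\<close> itself shows this.\<close>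
  moreover have "x \<in> N +>\<^bsub>M\<^esub> x" using x by (rule N.a_rcos_self)
  ultimately have "(\<Union>y\<in>N +>\<^bsub>M\<^esub> x. N +>\<^bsub>M\<^esub> (c \<odot>\<^bsub>M\<^esub> y)) = N +>\<^bsub>M\<^esub> (c \<odot>\<^bsub>M\<^esub> x)"
    by (smt (verit) SUP_eq_const ex_in_conv)
  then show "N +>\<^bsub>M\<^esub> (c \<odot>\<^bsub>M\<^esub> x) = c \<odot>\<^bsub>Q\<^esub> (N +>\<^bsub>M\<^esub> x)"
    by (simp add: quotient_module_def)
qed (auto simp: quotient_module_carrier)

text \<open>The projection is linear and onto: with representatives chosen and its linearity read
  from right to left, each axiom becomes the image of the same axiom in \<open>M\<close>.\<close>

lemma module_quotient_module: "module K (quotient_module K M N)"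
proof -
  \<comment> \<open>The zero of the quotient is stored as \<open>N\<close>; it has to be put into
    coset form before linearity can be used.\<close>
  have zero: "\<zero>\<^bsub>Q\<^esub> = N +>\<^bsub>M\<^esub> \<zero>\<^bsub>M\<^esub>"
    using N.a_subset by (simp add: quotient_module_def)
  note lin = linear_map_add[OF quotient_module_linear, symmetric]
    linear_map_smult[OF quotient_module_linear, symmetric]
  show ?thesis
  proof (rule moduleI[OF _ abelian_groupI], goal_cases)
    case 1
    show ?case by unfold_locales
  next
    case (7 U)
    then obtain x where "x \<in> carrier M" "U = N +>\<^bsub>M\<^esub> x" by (auto simp: quotient_module_carrier)
    then show ?case
      by (intro bexI[of _ "N +>\<^bsub>M\<^esub> (\<ominus>\<^bsub>M\<^esub> x)"])
        (auto simp: quotient_module_carrier zero lin M.l_neg)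
  qed (auto simp: quotient_module_carrier zero lin M.a_ac M.smult_l_distr M.smult_r_distr M.smult_assoc1)
qed

end

section \<open>Tensor products\<close>

definition bilinear_map where
  "bilinear_map K M N P \<beta> \<longleftrightarrow>
    (\<forall>x\<in>carrier M. linear_map K N P (\<beta> x)) \<and> (\<forall>y\<in>carrier N. linear_map K M P (\<lambda>x. \<beta> x y))"

lemma bilinear_mapI:
  assumes "\<And>x. x \<in> carrier M \<Longrightarrow> linear_map K N P (\<beta> x)"
    and "\<And>y. y \<in> carrier N \<Longrightarrow> linear_map K M P (\<lambda>x. \<beta> x y)"
  shows "bilinear_map K M N P \<beta>"
  using assms by (auto simp: bilinear_map_def)

lemma bilinear_mapD:
  assumes "bilinear_map K M N P \<beta>"
  shows "x \<in> carrier M \<Longrightarrow> linear_map K N P (\<beta> x)"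
    and "y \<in> carrier N \<Longrightarrow> linear_map K M P (\<lambda>x. \<beta> x y)"
  using assms by (auto simp: bilinear_map_def)

context
  fixes K :: "('a, 'r) ring_scheme" and M :: "('a, 'm, 's) module_scheme"
    and N :: "('a, 'n, 't) module_scheme"
  assumes M: "module K M" and N: "module K N"
begin

interpretation M: module K M by (rule M)
interpretation N: module K N by (rule N)

private abbreviation (input) "F \<equiv> free_module K (carrier M \<times> carrier N)"
private abbreviation (input) "T \<equiv> tensor_module K M N"

private lemma module_F: "module K F"
  by (rule module_free_module[OF M.R.is_cring])

interpretation F: module K F by (rule module_F)

private lemma basis_F: "\<lbrakk>x \<in> carrier M; y \<in> carrier N\<rbrakk> \<Longrightarrow> basis_vec K (x, y) \<in> carrier F"
  by (simp add: basis_vec_closed[OF M.R.is_cring])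

private lemma relations_F: "bilinear_relations K M N \<subseteq> carrier F"
proof -
  note cl = basis_F F.M.minus_closed F.M.a_closed F.smult_closed M.M.a_closed N.M.a_closed
    M.smult_closed N.smult_closed
  show ?thesis
    unfolding bilinear_relations_def Let_def
    by (intro Un_least subsetI; clarsimp simp del: free_module_simps simp: cl)
qed

private lemma kernel: "submodule (bilinear_kernel K M N) K F"
  unfolding bilinear_kernel_def by (rule F.module_span_submodule[OF relations_F])

lemma module_tensor_module: "module K (tensor_module K M N)"
  unfolding tensor_module_def by (rule module_quotient_module[OF module_F kernel])

interpretation T: module K T by (rule module_tensor_module)

private lemma proj_linear:
  "linear_map K F T (\<lambda>f. bilinear_kernel K M N +>\<^bsub>F\<^esub> f)"
  unfolding tensor_module_def by (rule quotient_module_linear[OF module_F kernel])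

private lemma proj_eqI:
  assumes "f \<in> carrier F" "g \<in> carrier F" "f \<ominus>\<^bsub>F\<^esub> g \<in> bilinear_relations K M N"
  shows "bilinear_kernel K M N +>\<^bsub>F\<^esub> f = bilinear_kernel K M N +>\<^bsub>F\<^esub> g"
  unfolding coset_eq_iff[OF module_F kernel assms(1,2)] unfolding bilinear_kernel_def
  by (rule subsetD[OF module_span_superset assms(3)])

lemma pure_tensor_closed:
  "\<lbrakk>x \<in> carrier M; y \<in> carrier N\<rbrakk> \<Longrightarrow> pure_tensor K M N x y \<in> carrier (tensor_module K M N)"
  unfolding pure_tensor_def by (rule linear_map_closed[OF proj_linear basis_F])

private lemma relations_mem:
  "\<lbrakk>x \<in> carrier M; x' \<in> carrier M; y \<in> carrier N\<rbrakk> \<Longrightarrow>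
    basis_vec K (x \<oplus>\<^bsub>M\<^esub> x', y) \<ominus>\<^bsub>F\<^esub> (basis_vec K (x, y) \<oplus>\<^bsub>F\<^esub> basis_vec K (x', y))
      \<in> bilinear_relations K M N"
  "\<lbrakk>x \<in> carrier M; y \<in> carrier N; y' \<in> carrier N\<rbrakk> \<Longrightarrow>
    basis_vec K (x, y \<oplus>\<^bsub>N\<^esub> y') \<ominus>\<^bsub>F\<^esub> (basis_vec K (x, y) \<oplus>\<^bsub>F\<^esub> basis_vec K (x, y'))
      \<in> bilinear_relations K M N"
  "\<lbrakk>c \<in> carrier K; x \<in> carrier M; y \<in> carrier N\<rbrakk> \<Longrightarrow>
    basis_vec K (c \<odot>\<^bsub>M\<^esub> x, y) \<ominus>\<^bsub>F\<^esub> (c \<odot>\<^bsub>F\<^esub> basis_vec K (x, y)) \<in> bilinear_relations K M N"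
  "\<lbrakk>c \<in> carrier K; x \<in> carrier M; y \<in> carrier N\<rbrakk> \<Longrightarrow>
    basis_vec K (x, c \<odot>\<^bsub>N\<^esub> y) \<ominus>\<^bsub>F\<^esub> (c \<odot>\<^bsub>F\<^esub> basis_vec K (x, y)) \<in> bilinear_relations K M N"
  unfolding bilinear_relations_def Let_def
  by (rule UnI1, rule UnI1, rule UnI1, blast) (rule UnI1, rule UnI1, rule UnI2, blast,
    rule UnI1, rule UnI2, blast, rule UnI2, blast)

text \<open>Each law takes two moves: a generator of the relations identifies two cosets, then the
  linear projection splits the second one.\<close>

lemma pure_tensor_bilinear:
  "bilinear_map K M N (tensor_module K M N) (pure_tensor K M N)"
proof -
  note cl = basis_F F.M.a_closed F.smult_closed M.M.a_closed N.M.a_closed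
    M.smult_closed N.smult_closed
  show ?thesis
  proof (intro bilinear_mapI linear_mapI pure_tensor_closed; (assumption | unfold pure_tensor_def))
    fix x y y' assume "x \<in> carrier M" "y \<in> carrier N" "y' \<in> carrier N"
    then show "bilinear_kernel K M N +>\<^bsub>F\<^esub> basis_vec K (x, y \<oplus>\<^bsub>N\<^esub> y') =
      (bilinear_kernel K M N +>\<^bsub>F\<^esub> basis_vec K (x, y)) \<oplus>\<^bsub>T\<^esub>
      (bilinear_kernel K M N +>\<^bsub>F\<^esub> basis_vec K (x, y'))"
      by (intro trans[OF proj_eqI linear_map_add[OF proj_linear]] relations_mem cl)
  next
    fix c x y assume "c \<in> carrier K" "x \<in> carrier M" "y \<in> carrier N"
    then show "bilinear_kernel K M N +>\<^bsub>F\<^esub> basis_vec K (x, c \<odot>\<^bsub>N\<^esub> y) =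
      c \<odot>\<^bsub>T\<^esub> (bilinear_kernel K M N +>\<^bsub>F\<^esub> basis_vec K (x, y))"
      by (intro trans[OF proj_eqI linear_map_smult[OF proj_linear]] relations_mem cl)
  next
    fix x x' y assume "x \<in> carrier M" "x' \<in> carrier M" "y \<in> carrier N"
    then show "bilinear_kernel K M N +>\<^bsub>F\<^esub> basis_vec K (x \<oplus>\<^bsub>M\<^esub> x', y) =
      (bilinear_kernel K M N +>\<^bsub>F\<^esub> basis_vec K (x, y)) \<oplus>\<^bsub>T\<^esub>
      (bilinear_kernel K M N +>\<^bsub>F\<^esub> basis_vec K (x', y))"
      by (intro trans[OF proj_eqI linear_map_add[OF proj_linear]] relations_mem cl)
  next
    fix c x y assume "c \<in> carrier K" "x \<in> carrier M" "y \<in> carrier N"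
    then show "bilinear_kernel K M N +>\<^bsub>F\<^esub> basis_vec K (c \<odot>\<^bsub>M\<^esub> x, y) =
      c \<odot>\<^bsub>T\<^esub> (bilinear_kernel K M N +>\<^bsub>F\<^esub> basis_vec K (x, y))"
      by (intro trans[OF proj_eqI linear_map_smult[OF proj_linear]] relations_mem cl)
  qed
qed

text \<open>The projection sends the basis vectors, which span the free module, to the pure
  tensors.\<close>

lemma module_span_pure_tensor:
  "module_span K (tensor_module K M N)
     {pure_tensor K M N x y | x y. x \<in> carrier M \<and> y \<in> carrier N} = carrier (tensor_module K M N)"
  (is "?S = _")
proof
  have sub: "{pure_tensor K M N x y | x y. x \<in> carrier M \<and> y \<in> carrier N} \<subseteq> carrier T"
    using pure_tensor_closed by auto
  show "?S \<subseteq> carrier T"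
    by (rule module_span_least[OF T.carrier_is_submodule sub])
  show "carrier T \<subseteq> ?S"
  proof
    fix u assume "u \<in> carrier T"
    then obtain f where f: "f \<in> carrier F" "u = bilinear_kernel K M N +>\<^bsub>F\<^esub> f"
      unfolding tensor_module_def quotient_module_carrier[OF module_F kernel] by auto
    have "bilinear_kernel K M N +>\<^bsub>F\<^esub> f \<in> ?S"
    proof (rule linear_map_span_subset[OF module_F module_tensor_module proj_linear
          T.module_span_submodule[OF sub], of "basis_vec K ` (carrier M \<times> carrier N)"])
      show "basis_vec K ` (carrier M \<times> carrier N) \<subseteq> carrier F"
        using basis_F by auto
      show "(\<lambda>f. bilinear_kernel K M N +>\<^bsub>F\<^esub> f) ` basis_vec K ` (carrier M \<times> carrier N) \<subseteq> ?S"
        by (rule subset_trans[OF _ module_span_superset]) (auto simp: pure_tensor_def)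
      show "f \<in> module_span K F (basis_vec K ` (carrier M \<times> carrier N))"
        using f(1) by (simp add: module_span_basis_vec[OF M.R.is_cring])
    qed
    then show "u \<in> ?S" by (simp add: f(2))
  qed
qed

text \<open>The uniqueness half of the universal property.\<close>

lemma tensor_eqI:
  assumes "module K P" "linear_map K (tensor_module K M N) P f" "linear_map K (tensor_module K M N) P g"
    and "\<And>x y. \<lbrakk>x \<in> carrier M; y \<in> carrier N\<rbrakk> \<Longrightarrow> f (pure_tensor K M N x y) = g (pure_tensor K M N x y)"
    and "u \<in> carrier (tensor_module K M N)"
  shows "f u = g u"
  by (rule linear_map_eqI[OF module_tensor_module assms(1-3) module_span_pure_tensor _ assms(5)])
    (auto simp: assms(4))

section \<open>Existence half of the universal property of the tensor product\<close>

context
  fixes P :: "('a, 'p, 'q) module_scheme" and \<beta>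
  assumes P: "module K P" and \<beta>: "bilinear_map K M N P \<beta>"
begin

interpretation P: module K P by (rule P)

private abbreviation (input) "L \<equiv> lin_ext K P (\<lambda>(x, y). \<beta> x y)"

private lemma \<beta>_closed: "\<lbrakk>x \<in> carrier M; y \<in> carrier N\<rbrakk> \<Longrightarrow> \<beta> x y \<in> carrier P"
  using bilinear_mapD(1)[OF \<beta>] linear_map_closed by metis

private lemma L: "linear_map K F P L"
  using \<beta>_closed by (intro lin_ext_linear[OF P]) auto

private lemma L_basis: "\<lbrakk>x \<in> carrier M; y \<in> carrier N\<rbrakk> \<Longrightarrow> L (basis_vec K (x, y)) = \<beta> x y"
  by (subst lin_ext_basis_vec[OF P, of _ "carrier M \<times> carrier N"]) (auto simp: \<beta>_closed)

text \<open>This is what makes \<open>tensor_lift\<close> well defined. The kernel is a span, so it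
  is enough that \<open>L\<close> kills the generators, and each of the four families of generators
  is killed by one of the four bilinearity laws of \<beta>.\<close>

private lemma L_kernel:
  assumes "f \<in> bilinear_kernel K M N"
  shows "L f = \<zero>\<^bsub>P\<^esub>"
proof -
  note cl = basis_F F.M.a_closed F.smult_closed M.M.a_closed N.M.a_closed
    M.smult_closed N.smult_closed
  note lin = linear_map_minus[OF module_F P L] linear_mapD(2,3)[OF L]
  note \<beta>1 = linear_mapD(2,3)[OF bilinear_mapD(1)[OF \<beta>]]
  note \<beta>2 = linear_mapD(2,3)[OF bilinear_mapD(2)[OF \<beta>]]
  have zero: "submodule {\<zero>\<^bsub>P\<^esub>} K P"
    by (rule P.submoduleI') auto
  have "L f \<in> {\<zero>\<^bsub>P\<^esub>}"
  proof (rule linear_map_span_subset[OF module_F P L zero relations_F])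
    have "L r = \<zero>\<^bsub>P\<^esub>" if "r \<in> bilinear_relations K M N" for r
      using that unfolding bilinear_relations_def Let_def
    proof (elim UnE CollectE exE conjE)
      fix x x' y assume *: "x \<in> carrier M" "x' \<in> carrier M" "y \<in> carrier N"
        and r: "r = basis_vec K (x \<oplus>\<^bsub>M\<^esub> x', y) \<ominus>\<^bsub>F\<^esub> (basis_vec K (x, y) \<oplus>\<^bsub>F\<^esub> basis_vec K (x', y))"
      show ?thesis
        using * unfolding r by (simp add: cl lin L_basis \<beta>2 \<beta>_closed P.M.minus_eq P.M.r_neg del: free_module_simps)
    next
      fix x y y' assume *: "x \<in> carrier M" "y \<in> carrier N" "y' \<in> carrier N"
        and r: "r = basis_vec K (x, y \<oplus>\<^bsub>N\<^esub> y') \<ominus>\<^bsub>F\<^esub> (basis_vec K (x, y) \<oplus>\<^bsub>F\<^esub> basis_vec K (x, y'))"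
      show ?thesis
        using * unfolding r by (simp add: cl lin L_basis \<beta>1 \<beta>_closed P.M.minus_eq P.M.r_neg del: free_module_simps)
    next
      fix c x y assume *: "c \<in> carrier K" "x \<in> carrier M" "y \<in> carrier N"
        and r: "r = basis_vec K (c \<odot>\<^bsub>M\<^esub> x, y) \<ominus>\<^bsub>F\<^esub> (c \<odot>\<^bsub>F\<^esub> basis_vec K (x, y))"
      show ?thesis
        using * unfolding r by (simp add: cl lin L_basis \<beta>2 \<beta>_closed P.M.minus_eq P.M.r_neg del: free_module_simps)
    next
      fix c x y assume *: "c \<in> carrier K" "x \<in> carrier M" "y \<in> carrier N"
        and r: "r = basis_vec K (x, c \<odot>\<^bsub>N\<^esub> y) \<ominus>\<^bsub>F\<^esub> (c \<odot>\<^bsub>F\<^esub> basis_vec K (x, y))"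
      show ?thesis
        using * unfolding r by (simp add: cl lin L_basis \<beta>1 \<beta>_closed P.M.minus_eq P.M.r_neg del: free_module_simps)
    qed
    then show "L ` bilinear_relations K M N \<subseteq> {\<zero>\<^bsub>P\<^esub>}" by blast
  qed (use assms in \<open>simp add: bilinear_kernel_def\<close>)
  then show ?thesis by simp
qed

private lemma lift_proj:
  assumes f: "f \<in> carrier F"
  shows "tensor_lift K P \<beta> (bilinear_kernel K M N +>\<^bsub>F\<^esub> f) = L f"
proof -
  have sub: "bilinear_kernel K M N \<subseteq> carrier F" using F.submoduleE(1)[OF kernel] .
  have "L (g \<oplus>\<^bsub>F\<^esub> f) = L f" if "g \<in> bilinear_kernel K M N" for g
    using linear_map_add[OF L, of g f] that sub f L_kernel[OF that] linear_map_closed[OF L f]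
    by (auto simp del: free_module_simps)
  \<comment> \<open>Besides being constant on the coset, \<open>L\<close> needs a non-empty coset
    for its image to be a singleton, as \<open>the_elem\<close> requires.\<close>
  moreover have "\<zero>\<^bsub>F\<^esub> \<in> bilinear_kernel K M N" by (rule F.submodule_zero[OF kernel])
  ultimately have "L ` (bilinear_kernel K M N +>\<^bsub>F\<^esub> f) = {L f}"
    unfolding a_r_coset_def' image_UN by (auto simp del: free_module_simps)
  then show ?thesis by (simp add: tensor_lift_def)
qed

lemma tensor_lift_linear: "linear_map K (tensor_module K M N) P (tensor_lift K P \<beta>)"
proof (rule linear_mapI)
  note carr = quotient_module_carrier[OF module_F kernel, folded tensor_module_def]
  note lin = linear_map_add[OF proj_linear, symmetric] linear_map_smult[OF proj_linear, symmetric]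
  fix u assume "u \<in> carrier T"
  then obtain f where f: "f \<in> carrier F" "u = bilinear_kernel K M N +>\<^bsub>F\<^esub> f" unfolding carr by auto
  show "tensor_lift K P \<beta> u \<in> carrier P"
    using linear_map_closed[OF L f(1)] by (simp add: f lift_proj)
  show "tensor_lift K P \<beta> (c \<odot>\<^bsub>T\<^esub> u) = c \<odot>\<^bsub>P\<^esub> tensor_lift K P \<beta> u" if "c \<in> carrier K" for c
    using that f(1) linear_map_smult[OF L]
    by (simp add: f(2) lin lift_proj F.smult_closed del: free_module_simps)
  fix v assume "v \<in> carrier T"
  then obtain g where g: "g \<in> carrier F" "v = bilinear_kernel K M N +>\<^bsub>F\<^esub> g" unfolding carr by auto
  show "tensor_lift K P \<beta> (u \<oplus>\<^bsub>T\<^esub> v) = tensor_lift K P \<beta> u \<oplus>\<^bsub>P\<^esub> tensor_lift K P \<beta> v"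
    using f(1) g(1) linear_map_add[OF L]
    by (simp add: f(2) g(2) lin lift_proj F.M.a_closed del: free_module_simps)
qed

lemma tensor_lift_pure:
  "\<lbrakk>x \<in> carrier M; y \<in> carrier N\<rbrakk> \<Longrightarrow> tensor_lift K P \<beta> (pure_tensor K M N x y) = \<beta> x y"
  by (simp add: pure_tensor_def lift_proj basis_F L_basis)

end

end

section \<open>Maps between tensor products: functoriality and associativity\<close>

lemma bilinear_map_compose:
  assumes "linear_map K M M' f" "linear_map K N N' g" "bilinear_map K M' N' P \<beta>"
  shows "bilinear_map K M N P (\<lambda>x y. \<beta> (f x) (g y))"
proof (rule bilinear_mapI)
  fix x assume "x \<in> carrier M"
  then have "linear_map K N' P (\<beta> (f x))"
    by (intro bilinear_mapD(1)[OF assms(3)] linear_map_closed[OF assms(1)])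
  then show "linear_map K N P (\<lambda>y. \<beta> (f x) (g y))"
    by (rule linear_map_compose[OF assms(2)])
next
  fix y assume "y \<in> carrier N"
  then have "linear_map K M' P (\<lambda>x. \<beta> x (g y))"
    by (intro bilinear_mapD(2)[OF assms(3)] linear_map_closed[OF assms(2)])
  then show "linear_map K M P (\<lambda>x. \<beta> (f x) (g y))"
    by (rule linear_map_compose[OF assms(1)])
qed

text \<open>The nested lifts in \<open>tensor_assoc\<close> and \<open>tensor_algebra\<close> carry
  an outer parameter \<open>z\<close>. Linearity in \<open>z\<close> is not visible at a general
  tensor \<open>u\<close>, but for fixed parameters both sides of each law are linear in
  \<open>u\<close>, so \<open>tensor_eqI\<close> reduces the law to pure \<open>u\<close>, where it
  is the linearity of \<gamma> in \<open>z\<close>.\<close>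

lemma tensor_lift_trilinear:
  assumes L: "module K L" and M: "module K M" and P: "module K P" and N: "module K N"
    and xy: "\<And>z. z \<in> carrier N \<Longrightarrow> bilinear_map K L M P (\<lambda>x y. \<gamma> x y z)"
    and z: "\<And>x y. \<lbrakk>x \<in> carrier L; y \<in> carrier M\<rbrakk> \<Longrightarrow> linear_map K N P (\<gamma> x y)"
  shows "bilinear_map K (tensor_module K L M) N P (\<lambda>u z. tensor_lift K P (\<lambda>x y. \<gamma> x y z) u)"
proof (rule bilinear_mapI)
  interpret N: module K N by (rule N)
  note lin = tensor_lift_linear[OF L M P xy] and pure = tensor_lift_pure[OF L M P xy]
  fix u assume u: "u \<in> carrier (tensor_module K L M)"
  show "linear_map K N P (\<lambda>z. tensor_lift K P (\<lambda>x y. \<gamma> x y z) u)"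
  proof (rule linear_mapI)
    fix a assume a: "a \<in> carrier N"
    show "tensor_lift K P (\<lambda>x y. \<gamma> x y a) u \<in> carrier P"
      by (rule linear_map_closed[OF lin[OF a] u])
    fix b assume b: "b \<in> carrier N"
    have ab: "a \<oplus>\<^bsub>N\<^esub> b \<in> carrier N" using a b by simp
    show "tensor_lift K P (\<lambda>x y. \<gamma> x y (a \<oplus>\<^bsub>N\<^esub> b)) u =
      tensor_lift K P (\<lambda>x y. \<gamma> x y a) u \<oplus>\<^bsub>P\<^esub> tensor_lift K P (\<lambda>x y. \<gamma> x y b) u"
      by (rule tensor_eqI[OF L M P lin[OF ab] linear_map_plus[OF P lin[OF a] lin[OF b]] _ u])
        (simp add: pure[OF ab] pure[OF a] pure[OF b] linear_map_add[OF z] a b)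
  next
    fix c a assume c: "c \<in> carrier K" and a: "a \<in> carrier N"
    have ca: "c \<odot>\<^bsub>N\<^esub> a \<in> carrier N" using c a by simp
    show "tensor_lift K P (\<lambda>x y. \<gamma> x y (c \<odot>\<^bsub>N\<^esub> a)) u = c \<odot>\<^bsub>P\<^esub> tensor_lift K P (\<lambda>x y. \<gamma> x y a) u"
      by (rule tensor_eqI[OF L M P lin[OF ca] linear_map_scale[OF P lin[OF a] c] _ u])
        (simp add: pure[OF ca] pure[OF a] linear_map_smult[OF z] a c)
  qed
qed (rule tensor_lift_linear[OF L M P xy])

context
  fixes K :: "('a, 'r) ring_scheme"
    and M :: "('a, 'm, 's) module_scheme" and N :: "('a, 'n, 't) module_scheme"
    and M' :: "('a, 'p, 'u) module_scheme" and N' :: "('a, 'q, 'v) module_scheme" and f g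
  assumes M: "module K M" and N: "module K N" and M': "module K M'" and N': "module K N'"
    and f: "linear_map K M M' f" and g: "linear_map K N N' g"
begin

lemma tensor_map_linear:
  "linear_map K (tensor_module K M N) (tensor_module K M' N') (tensor_map K M' N' f g)"
  unfolding tensor_map_def
  by (rule tensor_lift_linear[OF M N module_tensor_module[OF M' N']
        bilinear_map_compose[OF f g pure_tensor_bilinear[OF M' N']]])

lemma tensor_map_pure:
  "\<lbrakk>x \<in> carrier M; y \<in> carrier N\<rbrakk> \<Longrightarrow>
    tensor_map K M' N' f g (pure_tensor K M N x y) = pure_tensor K M' N' (f x) (g y)"
  unfolding tensor_map_def
  by (rule tensor_lift_pure[OF M N module_tensor_module[OF M' N']
        bilinear_map_compose[OF f g pure_tensor_bilinear[OF M' N']]])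

end

context
  fixes K :: "('a, 'r) ring_scheme" and L :: "('a, 'l, 'w) module_scheme"
    and M :: "('a, 'm, 's) module_scheme" and N :: "('a, 'n, 't) module_scheme"
  assumes L: "module K L" and M: "module K M" and N: "module K N"
begin

private lemma MN: "module K (tensor_module K M N)"
  by (rule module_tensor_module[OF M N])

private lemma LMN: "module K (tensor_module K L (tensor_module K M N))"
  by (rule module_tensor_module[OF L MN])

private lemma assoc_trilinear:
  assumes "z \<in> carrier N"
  shows "bilinear_map K L M (tensor_module K L (tensor_module K M N))
    (\<lambda>x y. pure_tensor K L (tensor_module K M N) x (pure_tensor K M N y z))"
  using bilinear_map_compose[OF linear_map_id bilinear_mapD(2)[OF pure_tensor_bilinear[OF M N] assms]
      pure_tensor_bilinear[OF L MN]] by simp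

private lemma assoc_bilinear:
  "bilinear_map K (tensor_module K L M) N (tensor_module K L (tensor_module K M N))
    (\<lambda>u z. tensor_lift K (tensor_module K L (tensor_module K M N))
      (\<lambda>x y. pure_tensor K L (tensor_module K M N) x (pure_tensor K M N y z)) u)"
proof (rule tensor_lift_trilinear[OF L M LMN N assoc_trilinear])
  fix x y assume "x \<in> carrier L" "y \<in> carrier M"
  then show "linear_map K N (tensor_module K L (tensor_module K M N))
    (\<lambda>z. pure_tensor K L (tensor_module K M N) x (pure_tensor K M N y z))"
    by (intro linear_map_compose[OF bilinear_mapD(1)[OF pure_tensor_bilinear[OF M N]]
          bilinear_mapD(1)[OF pure_tensor_bilinear[OF L MN]]])
qed

lemma tensor_assoc_linear:
  "linear_map K (tensor_module K (tensor_module K L M) N) (tensor_module K L (tensor_module K M N))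
    (tensor_assoc K L M N)"
  unfolding tensor_assoc_def Let_def
  by (rule tensor_lift_linear[OF module_tensor_module[OF L M] N LMN assoc_bilinear])

lemma tensor_assoc_pure:
  assumes "x \<in> carrier L" "y \<in> carrier M" "z \<in> carrier N"
  shows "tensor_assoc K L M N (pure_tensor K (tensor_module K L M) N (pure_tensor K L M x y) z) =
    pure_tensor K L (tensor_module K M N) x (pure_tensor K M N y z)"
  unfolding tensor_assoc_def Let_def
  by (simp add: tensor_lift_pure[OF module_tensor_module[OF L M] N LMN assoc_bilinear]
      tensor_lift_pure[OF L M LMN assoc_trilinear] pure_tensor_closed[OF L M] assms)

end

section \<open>Multiplication on the tensor product of two algebras\<close>

lemma tensor_algebra_simps [simp]:
  "carrier (tensor_algebra K A B) = carrier (tensor_module K A B)"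
  "add (tensor_algebra K A B) = add (tensor_module K A B)"
  "one (tensor_algebra K A B) = pure_tensor K A B \<one>\<^bsub>A\<^esub> \<one>\<^bsub>B\<^esub>"
  by (simp_all add: tensor_algebra_def Let_def)

context
  fixes K :: "('a, 'r) ring_scheme"
    and A :: "('a, 'm, 's) module_scheme" and B :: "('a, 'n, 't) module_scheme"
  assumes A: "module K A" and B: "module K B"
    and mult_A: "bilinear_map K A A A (mult A)" and mult_B: "bilinear_map K B B B (mult B)"
begin

private abbreviation (input) "AB \<equiv> tensor_module K A B"

private lemma module_AB: "module K AB"
  by (rule module_tensor_module[OF A B])

private lemma inner_bilinear:
  assumes "a \<in> carrier A" "b \<in> carrier B"
  shows "bilinear_map K A B AB (\<lambda>a' b'. pure_tensor K A B (a \<otimes>\<^bsub>A\<^esub> a') (b \<otimes>\<^bsub>B\<^esub> b'))"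
  by (rule bilinear_map_compose[OF bilinear_mapD(1)[OF mult_A assms(1)]
        bilinear_mapD(1)[OF mult_B assms(2)] pure_tensor_bilinear[OF A B]])

private lemma closed:
  "\<lbrakk>a \<in> carrier A; a' \<in> carrier A\<rbrakk> \<Longrightarrow> a \<otimes>\<^bsub>A\<^esub> a' \<in> carrier A"
  "\<lbrakk>b \<in> carrier B; b' \<in> carrier B\<rbrakk> \<Longrightarrow> b \<otimes>\<^bsub>B\<^esub> b' \<in> carrier B"
  using linear_map_closed[OF bilinear_mapD(1)[OF mult_A]]
    linear_map_closed[OF bilinear_mapD(1)[OF mult_B]] by auto

text \<open>Two uses of \<open>tensor_lift_trilinear\<close> with the primed pair as the lifted one:
  the third variable is \<open>b\<close> for fixed \<open>a\<close>, then \<open>a\<close> for fixed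
  \<open>b\<close>. Only the resulting linearity in that third variable, at the tensor
  \<open>v\<close>, is kept.\<close>

private lemma outer_bilinear:
  assumes v: "v \<in> carrier AB"
  shows "bilinear_map K A B AB (\<lambda>a b. tensor_lift K AB
    (\<lambda>a' b'. pure_tensor K A B (a \<otimes>\<^bsub>A\<^esub> a') (b \<otimes>\<^bsub>B\<^esub> b')) v)"
proof (rule bilinear_mapI)
  fix a assume a: "a \<in> carrier A"
  have "linear_map K B AB (\<lambda>b. pure_tensor K A B (a \<otimes>\<^bsub>A\<^esub> a') (b \<otimes>\<^bsub>B\<^esub> b'))"
    if "a' \<in> carrier A" "b' \<in> carrier B" for a' b'
    by (rule linear_map_compose[OF bilinear_mapD(2)[OF mult_B that(2)]
          bilinear_mapD(1)[OF pure_tensor_bilinear[OF A B] closed(1)[OF a that(1)]]])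
  from bilinear_mapD(1)[OF tensor_lift_trilinear[OF A B module_AB B inner_bilinear[OF a] this] v]
  show "linear_map K B AB (\<lambda>b. tensor_lift K AB
    (\<lambda>a' b'. pure_tensor K A B (a \<otimes>\<^bsub>A\<^esub> a') (b \<otimes>\<^bsub>B\<^esub> b')) v)" .
next
  fix b assume b: "b \<in> carrier B"
  have "linear_map K A AB (\<lambda>a. pure_tensor K A B (a \<otimes>\<^bsub>A\<^esub> a') (b \<otimes>\<^bsub>B\<^esub> b'))"
    if "a' \<in> carrier A" "b' \<in> carrier B" for a' b'
    by (rule linear_map_compose[OF bilinear_mapD(2)[OF mult_A that(1)]
          bilinear_mapD(2)[OF pure_tensor_bilinear[OF A B] closed(2)[OF b that(2)]]])
  from bilinear_mapD(1)[OF tensor_lift_trilinear[OF A B module_AB A inner_bilinear[OF _ b] this] v]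
  show "linear_map K A AB (\<lambda>a. tensor_lift K AB
    (\<lambda>a' b'. pure_tensor K A B (a \<otimes>\<^bsub>A\<^esub> a') (b \<otimes>\<^bsub>B\<^esub> b')) v)" .
qed

lemma tensor_algebra_mult_linear_left:
  assumes "v \<in> carrier (tensor_module K A B)"
  shows "linear_map K (tensor_module K A B) (tensor_module K A B) (\<lambda>u. u \<otimes>\<^bsub>tensor_algebra K A B\<^esub> v)"
  using tensor_lift_linear[OF A B module_AB outer_bilinear[OF assms]]
  by (simp add: tensor_algebra_def Let_def)

lemma tensor_algebra_pure_mult:
  assumes "a \<in> carrier A" "b \<in> carrier B" "v \<in> carrier (tensor_module K A B)"
  shows "pure_tensor K A B a b \<otimes>\<^bsub>tensor_algebra K A B\<^esub> v = tensor_lift K (tensor_module K A B)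
    (\<lambda>a' b'. pure_tensor K A B (a \<otimes>\<^bsub>A\<^esub> a') (b \<otimes>\<^bsub>B\<^esub> b')) v"
  using tensor_lift_pure[OF A B module_AB outer_bilinear] assms
  by (simp add: tensor_algebra_def Let_def)

text \<open>A pure left factor is the case that occurs: the right factor varies only while the left
  one is the comultiplication of a single group element.\<close>

lemma tensor_algebra_mult_linear_right:
  assumes "a \<in> carrier A" "b \<in> carrier B"
  shows "linear_map K (tensor_module K A B) (tensor_module K A B)
    (\<lambda>v. pure_tensor K A B a b \<otimes>\<^bsub>tensor_algebra K A B\<^esub> v)"
  by (rule linear_map_cong[OF tensor_lift_linear[OF A B module_AB inner_bilinear[OF assms]] _ module_AB])
    (simp add: tensor_algebra_pure_mult assms)

lemma tensor_algebra_mult_pure: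
  assumes "a \<in> carrier A" "b \<in> carrier B" "a' \<in> carrier A" "b' \<in> carrier B"
  shows "pure_tensor K A B a b \<otimes>\<^bsub>tensor_algebra K A B\<^esub> pure_tensor K A B a' b' =
    pure_tensor K A B (a \<otimes>\<^bsub>A\<^esub> a') (b \<otimes>\<^bsub>B\<^esub> b')"
  using assms
  by (simp add: tensor_algebra_pure_mult pure_tensor_closed[OF A B]
      tensor_lift_pure[OF A B module_AB inner_bilinear])

end

section \<open>Dependence on the module structure\<close>

lemma module_cong:
  assumes M: "module K M"
    and eq: "carrier M = carrier M'" "add M = add M'" "zero M = zero M'" "smult M = smult M'"
  shows "module K M'"
proof -
  interpret module K M by (rule M)
  have "\<exists>y\<in>carrier M'. y \<oplus>\<^bsub>M'\<^esub> x = \<zero>\<^bsub>M'\<^esub>" if "x \<in> carrier M'" for x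
    using that M.l_neg unfolding eq[symmetric] by blast
  then show ?thesis
    by (intro moduleI abelian_groupI)
      (auto simp: eq[symmetric] R.is_cring smult_l_distr smult_r_distr smult_assoc1 M.a_ac)
qed

lemma linear_map_cong_module:
  assumes "carrier M = carrier M'" "add M = add M'" "smult M = smult M'"
  shows "linear_map K M N f \<longleftrightarrow> linear_map K M' N f"
  using assms by (simp add: linear_map_def)

lemma finsum_cong_ring:
  assumes "carrier P = carrier P'" "add P = add P'" "zero P = zero P'"
  shows "finsum P = finsum P'"
  using assms by (intro ext) (simp add: finsum_def finprod_def)

lemma lin_ext_cong_module:
  assumes "carrier P = carrier P'" "add P = add P'" "zero P = zero P'" "smult P = smult P'"
  shows "lin_ext K P = lin_ext K P'"
  by (intro ext) (simp add: lin_ext_def finsum_cong_ring[OF assms(1-3)] assms(4))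

text \<open>The cosets depend only on these fields of the factors. Hence tensors over
  \<open>group_ring\<close>, which appear in the definition of the comultiplication, are literally
  tensors over \<open>group_algebra\<close>.\<close>

lemma tensor_module_cong:
  assumes "carrier M = carrier M'" "add M = add M'" "smult M = smult M'"
    and "carrier N = carrier N'" "add N = add N'" "smult N = smult N'"
  shows "tensor_module K M N = tensor_module K M' N'" "pure_tensor K M N = pure_tensor K M' N'"
  using assms
  by (simp_all add: tensor_module_def pure_tensor_def bilinear_kernel_def bilinear_relations_def fun_eq_iff)

text \<open>\<open>K\<close> as a module over itself, which gives the counit a codomain with an
  \<open>smult\<close> field and so makes it a \<open>linear_map\<close>.\<close>

definition regular_module :: "('a, 'r) ring_scheme \<Rightarrow> ('a, 'a) module" where
  "regular_module K = \<lparr>carrier = carrier K, monoid.mult = mult K, one = one K,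
    ring.zero = zero K, add = add K, smult = mult K\<rparr>"

lemma regular_module_simps [simp]:
  "carrier (regular_module K) = carrier K" "add (regular_module K) = add K"
  "zero (regular_module K) = zero K" "smult (regular_module K) = mult K"
  by (simp_all add: regular_module_def)

lemma module_regular_module:
  assumes "cring K"
  shows "module K (regular_module K)"
proof -
  interpret cring K by (rule assms)
  have "\<exists>y\<in>carrier K. y \<oplus>\<^bsub>K\<^esub> x = \<zero>\<^bsub>K\<^esub>" if "x \<in> carrier K" for x
    using that l_neg by blast
  then show ?thesis
    by (intro moduleI abelian_groupI) (auto simp: is_cring l_distr r_distr m_assoc a_ac)
qed

text \<open>The restricted comultiplication, a definite description, is left out: finite dimension,
  involutivity and unimodularity read only the fields listed here, so it never has to be
  evaluated.\<close>

lemma restrict_hopf_simps [simp]: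
  "carrier (restrict_hopf K H A) = A" "add (restrict_hopf K H A) = add H"
  "zero (restrict_hopf K H A) = zero H" "smult (restrict_hopf K H A) = smult H"
  "mult (restrict_hopf K H A) = mult H" "counit (restrict_hopf K H A) = counit H"
  "antipode (restrict_hopf K H A) = antipode H"
  by (simp_all add: restrict_hopf_def Let_def)

lemma free_module_carrier_mono:
  "S \<subseteq> U \<Longrightarrow> carrier (free_module K S) \<subseteq> carrier (free_module K U)"
  by (simp add: free_module_def) blast

text \<open>Since 1 differs from 0, the basis vector at a point of \<open>S\<close> detects that
  point. This is what makes the inclusions of the directed system proper.\<close>

lemma free_module_carrier_subset_iff:
  assumes "cring K" "\<one>\<^bsub>K\<^esub> \<noteq> \<zero>\<^bsub>K\<^esub>"
  shows "carrier (free_module K S) \<subseteq> carrier (free_module K U) \<longleftrightarrow> S \<subseteq> U"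
proof
  assume sub: "carrier (free_module K S) \<subseteq> carrier (free_module K U)"
  show "S \<subseteq> U"
  proof
    fix x assume "x \<in> S"
    then have "basis_vec K x \<in> carrier (free_module K U)"
      by (intro subsetD[OF sub] basis_vec_closed[OF assms(1)])
    from free_module_carrierD(3)[OF this, of x] show "x \<in> U"
      using assms(2) by (auto simp: basis_vec_def)
  qed
qed (rule free_module_carrier_mono)

section \<open>Group algebras\<close>

lemma group_algebra_module_simps:
  "carrier (group_algebra K G) = carrier (free_module K (carrier G))"
  "add (group_algebra K G) = add (free_module K (carrier G))"
  "zero (group_algebra K G) = zero (free_module K (carrier G))"
  "smult (group_algebra K G) = smult (free_module K (carrier G))"
  by (simp_all add: group_algebra_def Let_def module.defs group_ring_def)

lemma group_algebra_one: "\<one>\<^bsub>group_algebra K G\<^esub> = basis_vec K \<one>\<^bsub>G\<^esub>"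
  by (simp add: group_algebra_def Let_def module.defs group_ring_def)

lemma group_algebra_mult:
  "(f \<otimes>\<^bsub>group_algebra K G\<^esub> f') x =
    (\<Oplus>\<^bsub>K\<^esub>p\<in>{(y, z). f y \<noteq> \<zero>\<^bsub>K\<^esub> \<and> f' z \<noteq> \<zero>\<^bsub>K\<^esub> \<and> y \<otimes>\<^bsub>G\<^esub> z = x}. f (fst p) \<otimes>\<^bsub>K\<^esub> f' (snd p))"
  by (simp add: group_algebra_def Let_def module.defs group_ring_def)

context
  fixes K :: "('a, 'r) ring_scheme" and G :: "('g, 'm) monoid_scheme"
  assumes K: "cring K" and G: "group G"
begin

interpretation K: cring K by (rule K)
interpretation G: group G by (rule G)

private abbreviation (input) "H \<equiv> group_algebra K G"
private abbreviation (input) "e \<equiv> basis_vec K"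

lemma module_group_algebra: "module K (group_algebra K G)"
  by (rule module_cong[OF module_free_module[OF K]]) (simp_all only: group_algebra_module_simps)

interpretation H: module K H by (rule module_group_algebra)

lemma group_algebra_basis_closed: "g \<in> carrier G \<Longrightarrow> basis_vec K g \<in> carrier (group_algebra K G)"
  by (simp add: group_algebra_module_simps basis_vec_closed[OF K])

lemma module_span_group_algebra:
  "module_span K (group_algebra K G) (basis_vec K ` carrier G) = carrier (group_algebra K G)"
  using module_span_basis_vec[OF K, of "carrier G"]
    module_span_cong[of "group_algebra K G" "free_module K (carrier G)" K]
  by (simp only: group_algebra_module_simps)

lemma group_algebra_eqI:
  assumes "module K P" "linear_map K (group_algebra K G) P f" "linear_map K (group_algebra K G) P f'"
    and "\<And>g. g \<in> carrier G \<Longrightarrow> f (basis_vec K g) = f' (basis_vec K g)"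
    and "x \<in> carrier (group_algebra K G)"
  shows "f x = f' x"
  by (rule linear_map_eqI[OF module_group_algebra assms(1-3) module_span_group_algebra _ assms(5)])
    (auto simp: assms(4))

section \<open>The convolution product and the ring axioms\<close>

private lemma HD:
  assumes "f \<in> carrier H"
  shows "f x \<in> carrier K" "finite {x. f x \<noteq> \<zero>\<^bsub>K\<^esub>}" "x \<notin> carrier G \<Longrightarrow> f x = \<zero>\<^bsub>K\<^esub>"
    "{x. f x \<noteq> \<zero>\<^bsub>K\<^esub>} \<subseteq> carrier G"
  using free_module_carrierD[OF assms[unfolded group_algebra_module_simps]] by blast+

text \<open>Elements of the group algebra are functions on a whole type, so equality must also be
  checked off the group; there no pair from the two supports has the required product.\<close>

lemma group_algebra_mult_outside:
  assumes f: "f \<in> carrier (group_algebra K G)" and f': "f' \<in> carrier (group_algebra K G)"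
    and x: "x \<notin> carrier G"
  shows "(f \<otimes>\<^bsub>group_algebra K G\<^esub> f') x = \<zero>\<^bsub>K\<^esub>"
proof -
  have "{(y, z). f y \<noteq> \<zero>\<^bsub>K\<^esub> \<and> f' z \<noteq> \<zero>\<^bsub>K\<^esub> \<and> y \<otimes>\<^bsub>G\<^esub> z = x} = {}"
    using HD(4)[OF f] HD(4)[OF f'] x by auto
  then show ?thesis by (simp only: group_algebra_mult K.finsum_empty)
qed

text \<open>A pair with product \<open>x\<close> is determined by its first entry, so the sum over
  pairs becomes a sum over \<open>A\<close>, an index set that does not involve
  \<open>f'\<close>.\<close>

lemma group_algebra_mult_left:
  assumes f: "f \<in> carrier (group_algebra K G)" and f': "f' \<in> carrier (group_algebra K G)"
    and x: "x \<in> carrier G" and A: "finite A" "{y. f y \<noteq> \<zero>\<^bsub>K\<^esub>} \<subseteq> A" "A \<subseteq> carrier G"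
  shows "(f \<otimes>\<^bsub>group_algebra K G\<^esub> f') x = (\<Oplus>\<^bsub>K\<^esub>y\<in>A. f y \<otimes>\<^bsub>K\<^esub> f' (inv\<^bsub>G\<^esub> y \<otimes>\<^bsub>G\<^esub> x))"
proof -
  let ?h = "\<lambda>y. (y, inv\<^bsub>G\<^esub> y \<otimes>\<^bsub>G\<^esub> x)"
  \<comment> \<open>The definition admits only pairs at which both factors are nonzero; the
    remaining points of \<open>A\<close> are added at the end as zero terms.\<close>
  let ?B = "{y \<in> A. f y \<noteq> \<zero>\<^bsub>K\<^esub> \<and> f' (inv\<^bsub>G\<^esub> y \<otimes>\<^bsub>G\<^esub> x) \<noteq> \<zero>\<^bsub>K\<^esub>}"
  have "{(y, z). f y \<noteq> \<zero>\<^bsub>K\<^esub> \<and> f' z \<noteq> \<zero>\<^bsub>K\<^esub> \<and> y \<otimes>\<^bsub>G\<^esub> z = x} = ?h ` ?B" (is "?S = _")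
  proof (intro equalityI subsetI)
    fix p assume "p \<in> ?S"
    then obtain y z where p: "p = (y, z)" and yz: "f y \<noteq> \<zero>\<^bsub>K\<^esub>" "f' z \<noteq> \<zero>\<^bsub>K\<^esub>" "y \<otimes>\<^bsub>G\<^esub> z = x"
      by auto
    have "y \<in> carrier G" "z \<in> carrier G" using HD(4)[OF f] HD(4)[OF f'] yz by auto
    then have "z = inv\<^bsub>G\<^esub> y \<otimes>\<^bsub>G\<^esub> x" using yz(3) G.inv_solve_left x by metis
    then show "p \<in> ?h ` ?B" using p yz A(2) by auto
  next
    fix p assume "p \<in> ?h ` ?B"
    then obtain y where "y \<in> ?B" "p = ?h y" by blast
    moreover from this have "y \<in> carrier G" using A(3) by auto
    ultimately show "p \<in> ?S" using x by (simp add: G.m_assoc[symmetric])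
  qed
  then have "(f \<otimes>\<^bsub>H\<^esub> f') x = (\<Oplus>\<^bsub>K\<^esub>p\<in>?h ` ?B. f (fst p) \<otimes>\<^bsub>K\<^esub> f' (snd p))"
    by (simp only: group_algebra_mult)
  also have "\<dots> = (\<Oplus>\<^bsub>K\<^esub>y\<in>?B. f y \<otimes>\<^bsub>K\<^esub> f' (inv\<^bsub>G\<^esub> y \<otimes>\<^bsub>G\<^esub> x))"
    by (subst K.finsum_reindex) (auto simp: HD(1)[OF f] HD(1)[OF f'] inj_on_def)
  also have "\<dots> = (\<Oplus>\<^bsub>K\<^esub>y\<in>A. f y \<otimes>\<^bsub>K\<^esub> f' (inv\<^bsub>G\<^esub> y \<otimes>\<^bsub>G\<^esub> x))"
    using A(1) HD(1)[OF f] HD(1)[OF f']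
    by (intro K.add.finprod_mono_neutral_cong_left) auto
  finally show ?thesis .
qed

lemma group_algebra_mult_right:
  assumes f: "f \<in> carrier (group_algebra K G)" and f': "f' \<in> carrier (group_algebra K G)"
    and x: "x \<in> carrier G" and A: "finite A" "{y. f' y \<noteq> \<zero>\<^bsub>K\<^esub>} \<subseteq> A" "A \<subseteq> carrier G"
  shows "(f \<otimes>\<^bsub>group_algebra K G\<^esub> f') x = (\<Oplus>\<^bsub>K\<^esub>z\<in>A. f (x \<otimes>\<^bsub>G\<^esub> inv\<^bsub>G\<^esub> z) \<otimes>\<^bsub>K\<^esub> f' z)"
proof -
  let ?h = "\<lambda>z. (x \<otimes>\<^bsub>G\<^esub> inv\<^bsub>G\<^esub> z, z)"
  let ?B = "{z \<in> A. f (x \<otimes>\<^bsub>G\<^esub> inv\<^bsub>G\<^esub> z) \<noteq> \<zero>\<^bsub>K\<^esub> \<and> f' z \<noteq> \<zero>\<^bsub>K\<^esub>}"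
  have "{(y, z). f y \<noteq> \<zero>\<^bsub>K\<^esub> \<and> f' z \<noteq> \<zero>\<^bsub>K\<^esub> \<and> y \<otimes>\<^bsub>G\<^esub> z = x} = ?h ` ?B" (is "?S = _")
  proof (intro equalityI subsetI)
    fix p assume "p \<in> ?S"
    then obtain y z where p: "p = (y, z)" and yz: "f y \<noteq> \<zero>\<^bsub>K\<^esub>" "f' z \<noteq> \<zero>\<^bsub>K\<^esub>" "y \<otimes>\<^bsub>G\<^esub> z = x"
      by auto
    have "y \<in> carrier G" "z \<in> carrier G" using HD(4)[OF f] HD(4)[OF f'] yz by auto
    then have "y = x \<otimes>\<^bsub>G\<^esub> inv\<^bsub>G\<^esub> z" using yz(3) G.inv_solve_right x by metis
    then show "p \<in> ?h ` ?B" using p yz A(2) by auto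
  next
    fix p assume "p \<in> ?h ` ?B"
    then obtain z where "z \<in> ?B" "p = ?h z" by blast
    moreover from this have "z \<in> carrier G" using A(3) by auto
    ultimately show "p \<in> ?S" using x by (simp add: G.m_assoc)
  qed
  then have "(f \<otimes>\<^bsub>H\<^esub> f') x = (\<Oplus>\<^bsub>K\<^esub>p\<in>?h ` ?B. f (fst p) \<otimes>\<^bsub>K\<^esub> f' (snd p))"
    by (simp only: group_algebra_mult)
  also have "\<dots> = (\<Oplus>\<^bsub>K\<^esub>z\<in>?B. f (x \<otimes>\<^bsub>G\<^esub> inv\<^bsub>G\<^esub> z) \<otimes>\<^bsub>K\<^esub> f' z)"
    by (subst K.finsum_reindex) (auto simp: HD(1)[OF f] HD(1)[OF f'] inj_on_def)
  also have "\<dots> = (\<Oplus>\<^bsub>K\<^esub>z\<in>A. f (x \<otimes>\<^bsub>G\<^esub> inv\<^bsub>G\<^esub> z) \<otimes>\<^bsub>K\<^esub> f' z)"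
    using A(1) HD(1)[OF f] HD(1)[OF f']
    by (intro K.add.finprod_mono_neutral_cong_left) auto
  finally show ?thesis .
qed

lemma group_algebra_mult_closed:
  assumes f: "f \<in> carrier (group_algebra K G)" and f': "f' \<in> carrier (group_algebra K G)"
  shows "f \<otimes>\<^bsub>group_algebra K G\<^esub> f' \<in> carrier (group_algebra K G)"
proof -
  \<comment> \<open>The product set of the two supports: finite, and it contains the support of the
    product.\<close>
  let ?s = "(\<lambda>(y, z). y \<otimes>\<^bsub>G\<^esub> z) ` ({y. f y \<noteq> \<zero>\<^bsub>K\<^esub>} \<times> {z. f' z \<noteq> \<zero>\<^bsub>K\<^esub>})"
  have "(f \<otimes>\<^bsub>H\<^esub> f') x = \<zero>\<^bsub>K\<^esub>" if "x \<notin> ?s" for x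
  proof -
    have "{(y, z). f y \<noteq> \<zero>\<^bsub>K\<^esub> \<and> f' z \<noteq> \<zero>\<^bsub>K\<^esub> \<and> y \<otimes>\<^bsub>G\<^esub> z = x} = {}"
      using that by auto
    then show ?thesis by (simp only: group_algebra_mult K.finsum_empty)
  qed
  then have "{x. (f \<otimes>\<^bsub>H\<^esub> f') x \<noteq> \<zero>\<^bsub>K\<^esub>} \<subseteq> ?s" by blast
  then have "finite {x. (f \<otimes>\<^bsub>H\<^esub> f') x \<noteq> \<zero>\<^bsub>K\<^esub>}"
    by (rule finite_subset) (intro finite_imageI finite_cartesian_product HD(2) f f')
  moreover have "(f \<otimes>\<^bsub>H\<^esub> f') x \<in> carrier K" for x
    unfolding group_algebra_mult using HD(1)[OF f] HD(1)[OF f'] by (intro K.finsum_closed) auto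
  ultimately show ?thesis
    using group_algebra_mult_outside[OF f f']
    by (simp add: group_algebra_module_simps free_module_carrier)
qed

text \<open>In each law the sum is taken over the support of the factor that stays fixed, through
  \<open>group_algebra_mult_left\<close> or \<open>group_algebra_mult_right\<close>. The index set
  is then the same on both sides and the law holds termwise.\<close>

lemma group_algebra_mult_bilinear:
  "bilinear_map K (group_algebra K G) (group_algebra K G) (group_algebra K G) (mult (group_algebra K G))"
proof (intro bilinear_mapI linear_mapI group_algebra_mult_closed; assumption?)
  fix f f' f'' assume f: "f \<in> carrier H" and f': "f' \<in> carrier H" and f'': "f'' \<in> carrier H"
  note A = HD(2)[OF f] order_refl HD(4)[OF f]
  show "f \<otimes>\<^bsub>H\<^esub> (f' \<oplus>\<^bsub>H\<^esub> f'') = f \<otimes>\<^bsub>H\<^esub> f' \<oplus>\<^bsub>H\<^esub> f \<otimes>\<^bsub>H\<^esub> f''"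
  proof
    fix x
    show "(f \<otimes>\<^bsub>H\<^esub> (f' \<oplus>\<^bsub>H\<^esub> f'')) x = (f \<otimes>\<^bsub>H\<^esub> f' \<oplus>\<^bsub>H\<^esub> f \<otimes>\<^bsub>H\<^esub> f'') x"
    proof (cases "x \<in> carrier G")
      case True
      then show ?thesis
        using HD(1)[OF f] HD(1)[OF f'] HD(1)[OF f''] group_algebra_mult_left[OF f _ True A] H.M.a_closed[OF f' f'']
        by (simp add: f' f'' group_algebra_module_simps(2-4) K.r_distr Pi_def)
    qed (use f f' f'' H.M.a_closed[OF f' f''] in
        \<open>simp add: group_algebra_mult_outside group_algebra_module_simps(2-4)\<close>)
  qed
next
  fix c f f' assume c: "c \<in> carrier K" and f: "f \<in> carrier H" and f': "f' \<in> carrier H"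
  note A = HD(2)[OF f] order_refl HD(4)[OF f]
  show "f \<otimes>\<^bsub>H\<^esub> (c \<odot>\<^bsub>H\<^esub> f') = c \<odot>\<^bsub>H\<^esub> (f \<otimes>\<^bsub>H\<^esub> f')"
  proof
    fix x
    show "(f \<otimes>\<^bsub>H\<^esub> (c \<odot>\<^bsub>H\<^esub> f')) x = (c \<odot>\<^bsub>H\<^esub> (f \<otimes>\<^bsub>H\<^esub> f')) x"
    proof (cases "x \<in> carrier G")
      case True
      then show ?thesis
        using HD(1)[OF f] HD(1)[OF f'] group_algebra_mult_left[OF f _ True A] H.smult_closed[OF c f']
        by (simp add: c f' group_algebra_module_simps(2-4) K.m_lcomm[of _ c] Pi_def K.finsum_rdistr[OF HD(2)[OF f] c])
    qed (use c f f' H.smult_closed[OF c f'] in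
        \<open>simp add: group_algebra_mult_outside group_algebra_module_simps(2-4)\<close>)
  qed
next
  fix f f' f'' assume f: "f \<in> carrier H" and f': "f' \<in> carrier H" and f'': "f'' \<in> carrier H"
  note A = HD(2)[OF f] order_refl HD(4)[OF f]
  show "(f' \<oplus>\<^bsub>H\<^esub> f'') \<otimes>\<^bsub>H\<^esub> f = f' \<otimes>\<^bsub>H\<^esub> f \<oplus>\<^bsub>H\<^esub> f'' \<otimes>\<^bsub>H\<^esub> f"
  proof
    fix x
    show "((f' \<oplus>\<^bsub>H\<^esub> f'') \<otimes>\<^bsub>H\<^esub> f) x = (f' \<otimes>\<^bsub>H\<^esub> f \<oplus>\<^bsub>H\<^esub> f'' \<otimes>\<^bsub>H\<^esub> f) x"
    proof (cases "x \<in> carrier G")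
      case True
      then show ?thesis
        using HD(1)[OF f] HD(1)[OF f'] HD(1)[OF f''] group_algebra_mult_right[OF _ f True A] H.M.a_closed[OF f' f'']
        by (simp add: f' f'' group_algebra_module_simps(2-4) K.l_distr Pi_def)
    qed (use f f' f'' H.M.a_closed[OF f' f''] in
        \<open>simp add: group_algebra_mult_outside group_algebra_module_simps(2-4)\<close>)
  qed
next
  fix c f f' assume c: "c \<in> carrier K" and f: "f \<in> carrier H" and f': "f' \<in> carrier H"
  note A = HD(2)[OF f] order_refl HD(4)[OF f]
  show "(c \<odot>\<^bsub>H\<^esub> f') \<otimes>\<^bsub>H\<^esub> f = c \<odot>\<^bsub>H\<^esub> (f' \<otimes>\<^bsub>H\<^esub> f)"
  proof
    fix x
    show "((c \<odot>\<^bsub>H\<^esub> f') \<otimes>\<^bsub>H\<^esub> f) x = (c \<odot>\<^bsub>H\<^esub> (f' \<otimes>\<^bsub>H\<^esub> f)) x"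
    proof (cases "x \<in> carrier G")
      case True
      then show ?thesis
        using HD(1)[OF f] HD(1)[OF f'] group_algebra_mult_right[OF _ f True A] H.smult_closed[OF c f']
        by (simp add: c f' group_algebra_module_simps(2-4) K.m_assoc Pi_def K.finsum_rdistr[OF HD(2)[OF f] c])
    qed (use c f f' H.smult_closed[OF c f'] in
        \<open>simp add: group_algebra_mult_outside group_algebra_module_simps(2-4)\<close>)
  qed
qed

private lemmas mult_right = bilinear_mapD(1)[OF group_algebra_mult_bilinear]
private lemmas mult_left = bilinear_mapD(2)[OF group_algebra_mult_bilinear]

text \<open>Multiplication by a group element is translation: the convolution has the single term at
  \<open>g\<close>. This drives the computation of the integrals.\<close>

lemma group_algebra_basis_mult_left:
  assumes "g \<in> carrier G" "f \<in> carrier (group_algebra K G)" "x \<in> carrier G"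
  shows "(basis_vec K g \<otimes>\<^bsub>group_algebra K G\<^esub> f) x = f (inv\<^bsub>G\<^esub> g \<otimes>\<^bsub>G\<^esub> x)"
proof -
  have "{y. e g y \<noteq> \<zero>\<^bsub>K\<^esub>} \<subseteq> {g}" by (auto simp: basis_vec_def)
  from group_algebra_mult_left[OF group_algebra_basis_closed[OF assms(1)] assms(2,3) _ this]
  show ?thesis using assms(1) HD(1)[OF assms(2)] by (simp add: basis_vec_def[of K g])
qed

lemma group_algebra_basis_mult_right:
  assumes "g \<in> carrier G" "f \<in> carrier (group_algebra K G)" "x \<in> carrier G"
  shows "(f \<otimes>\<^bsub>group_algebra K G\<^esub> basis_vec K g) x = f (x \<otimes>\<^bsub>G\<^esub> inv\<^bsub>G\<^esub> g)"
proof -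
  have "{y. e g y \<noteq> \<zero>\<^bsub>K\<^esub>} \<subseteq> {g}" by (auto simp: basis_vec_def)
  from group_algebra_mult_right[OF assms(2) group_algebra_basis_closed[OF assms(1)] assms(3) _ this]
  show ?thesis using assms(1) HD(1)[OF assms(2)] by (simp add: basis_vec_def[of K g])
qed

lemma group_algebra_basis_mult:
  assumes "g \<in> carrier G" "h \<in> carrier G"
  shows "basis_vec K g \<otimes>\<^bsub>group_algebra K G\<^esub> basis_vec K h = basis_vec K (g \<otimes>\<^bsub>G\<^esub> h)"
proof
  fix x
  show "(e g \<otimes>\<^bsub>H\<^esub> e h) x = e (g \<otimes>\<^bsub>G\<^esub> h) x"
  proof (cases "x \<in> carrier G")
    case True
    then have "inv\<^bsub>G\<^esub> g \<otimes>\<^bsub>G\<^esub> x = h \<longleftrightarrow> x = g \<otimes>\<^bsub>G\<^esub> h"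
      using assms by (metis G.inv_solve_left)
    then show ?thesis
      using True assms
      by (simp add: group_algebra_basis_mult_left group_algebra_basis_closed) (simp add: basis_vec_def)
  next
    case False
    then show ?thesis
      using assms
      by (simp add: group_algebra_mult_outside group_algebra_basis_closed) (auto simp: basis_vec_def)
  qed
qed

text \<open>Associativity on group elements is that of \<open>G\<close>. It is extended by linearity
  in the last variable (fact \<open>1\<close>), then in the middle one (fact \<open>2\<close>), then
  in the first (fact \<open>3\<close>).\<close>

lemma ring_group_algebra: "ring (group_algebra K G)"
proof (rule ringI)
  note eqI = group_algebra_eqI[OF module_group_algebra]
  note cl = group_algebra_basis_closed group_algebra_mult_closed
  have 1: "(e g \<otimes>\<^bsub>H\<^esub> e h) \<otimes>\<^bsub>H\<^esub> z = e g \<otimes>\<^bsub>H\<^esub> (e h \<otimes>\<^bsub>H\<^esub> z)"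
    if "g \<in> carrier G" "h \<in> carrier G" "z \<in> carrier H" for g h z
    by (rule eqI[OF mult_right linear_map_compose[OF mult_right mult_right] _ that(3)])
      (simp_all add: that cl group_algebra_basis_mult G.m_assoc)
  have 2: "(e g \<otimes>\<^bsub>H\<^esub> y) \<otimes>\<^bsub>H\<^esub> z = e g \<otimes>\<^bsub>H\<^esub> (y \<otimes>\<^bsub>H\<^esub> z)"
    if "g \<in> carrier G" "y \<in> carrier H" "z \<in> carrier H" for g y z
    by (rule eqI[OF linear_map_compose[OF mult_right mult_left]
          linear_map_compose[OF mult_left mult_right] _ that(2)])
      (simp_all add: that cl 1)
  have 3: "(x \<otimes>\<^bsub>H\<^esub> y) \<otimes>\<^bsub>H\<^esub> z = x \<otimes>\<^bsub>H\<^esub> (y \<otimes>\<^bsub>H\<^esub> z)"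
    if "x \<in> carrier H" "y \<in> carrier H" "z \<in> carrier H" for x y z
    by (rule eqI[OF linear_map_compose[OF mult_left mult_left] mult_left _ that(1)])
      (simp_all add: that cl 2)
  have l_one: "\<one>\<^bsub>H\<^esub> \<otimes>\<^bsub>H\<^esub> x = x" if "x \<in> carrier H" for x
    using eqI[OF mult_right linear_map_id _ that]
    by (simp add: cl group_algebra_one group_algebra_basis_mult)
  have r_one: "x \<otimes>\<^bsub>H\<^esub> \<one>\<^bsub>H\<^esub> = x" if "x \<in> carrier H" for x
    using eqI[OF mult_left linear_map_id _ that]
    by (simp add: cl group_algebra_one group_algebra_basis_mult)
  show "monoid H"
    by (rule monoidI) (simp_all add: cl 3 l_one r_one, simp add: group_algebra_one cl)
  show "abelian_group H" by unfold_locales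
qed (use linear_map_add[OF mult_left] linear_map_add[OF mult_right] in auto)

lemma assoc_algebra_group_algebra: "assoc_algebra K (group_algebra K G)"
  by (intro assoc_algebra.intro assoc_algebra_axioms.intro module_group_algebra ring_group_algebra)
    (use linear_map_smult[OF mult_left] linear_map_smult[OF mult_right] in auto)

subsection \<open>Comultiplication, counit and antipode\<close>

private abbreviation (input) "HH \<equiv> tensor_module K H H"

private lemmas H = module_group_algebra
private lemmas HH = module_tensor_module[OF H H]
private lemmas e_closed = group_algebra_basis_closed
private lemmas eqI = group_algebra_eqI
private lemmas mult_bilinear = group_algebra_mult_bilinear
private lemmas basis_mult = group_algebra_basis_mult

lemma linear_map_group_algebra_iff:
  "linear_map K (group_algebra K G) P f \<longleftrightarrow> linear_map K (free_module K (carrier G)) P f"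
  by (rule linear_map_cong_module) (simp_all only: group_algebra_module_simps)

lemma group_algebra_comult_conv_lin_ext:
  "comult (group_algebra K G) = lin_ext K (tensor_module K (group_algebra K G) (group_algebra K G))
    (\<lambda>g. pure_tensor K (group_algebra K G) (group_algebra K G) (basis_vec K g) (basis_vec K g))"
proof -
  have eq: "carrier (group_ring K G) = carrier H" "add (group_ring K G) = add H"
    "smult (group_ring K G) = smult H"
    by (simp_all add: group_algebra_module_simps group_ring_def)
  have "comult H = lin_ext K (tensor_module K (group_ring K G) (group_ring K G))
    (\<lambda>g. pure_tensor K (group_ring K G) (group_ring K G) (basis_vec K g) (basis_vec K g))"
    by (simp add: group_algebra_def Let_def module.defs)
  then show ?thesis
    unfolding tensor_module_cong[OF eq eq] .
qed

lemma group_algebra_antipode_conv_lin_ext: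
  "antipode (group_algebra K G) = lin_ext K (group_algebra K G) (\<lambda>g. basis_vec K (inv\<^bsub>G\<^esub> g))"
proof -
  have "antipode H = lin_ext K (group_ring K G) (\<lambda>g. basis_vec K (inv\<^bsub>G\<^esub> g))"
    by (simp add: group_algebra_def Let_def module.defs)
  \<comment> \<open>The type annotation fixes the index type of the basis map, which the equation
    between functions would otherwise leave open.\<close>
  also have "lin_ext K (group_ring K G) = (lin_ext K H :: ('g \<Rightarrow> 'g \<Rightarrow> 'a) \<Rightarrow> _)"
    by (rule lin_ext_cong_module) (simp_all add: group_algebra_module_simps group_ring_def)
  finally show ?thesis .
qed

text \<open>Inserting a factor 1 shows the sum of coefficients to be the linear extension of the
  constant 1. Coefficients must lie in \<open>K\<close> for this, hence the restriction to the
  carrier.\<close>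

lemma group_algebra_counit_conv_lin_ext:
  assumes "f \<in> carrier (group_algebra K G)"
  shows "counit (group_algebra K G) f = lin_ext K (regular_module K) (\<lambda>_. \<one>\<^bsub>K\<^esub>) f"
proof -
  have f: "f x \<in> carrier K" for x
    using assms by (simp add: group_algebra_module_simps free_module_carrier)
  have "counit H f = (\<Oplus>\<^bsub>K\<^esub>g\<in>{g. f g \<noteq> \<zero>\<^bsub>K\<^esub>}. f g \<otimes>\<^bsub>K\<^esub> \<one>\<^bsub>K\<^esub>)"
    by (simp add: group_algebra_def Let_def module.defs f)
  also have "\<dots> = lin_ext K (regular_module K) (\<lambda>_. \<one>\<^bsub>K\<^esub>) f"
    by (simp add: lin_ext_def finsum_cong_ring[of "regular_module K" K])
  finally show ?thesis .
qed

lemma group_algebra_comult_linear: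
  "linear_map K (group_algebra K G) (tensor_module K (group_algebra K G) (group_algebra K G))
    (comult (group_algebra K G))"
  unfolding group_algebra_comult_conv_lin_ext linear_map_group_algebra_iff
  by (intro lin_ext_linear[OF HH] funcsetI pure_tensor_closed[OF H H] e_closed)

lemma group_algebra_comult_basis:
  assumes "g \<in> carrier G"
  shows "comult (group_algebra K G) (basis_vec K g) =
    pure_tensor K (group_algebra K G) (group_algebra K G) (basis_vec K g) (basis_vec K g)"
  unfolding group_algebra_comult_conv_lin_ext
  by (intro lin_ext_basis_vec[OF HH _ assms] funcsetI pure_tensor_closed[OF H H] e_closed)

lemma group_algebra_antipode_linear:
  "linear_map K (group_algebra K G) (group_algebra K G) (antipode (group_algebra K G))"
  unfolding group_algebra_antipode_conv_lin_ext
  unfolding linear_map_group_algebra_iff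
  by (intro lin_ext_linear[OF H] funcsetI e_closed G.inv_closed)

lemma group_algebra_antipode_basis:
  assumes "g \<in> carrier G"
  shows "antipode (group_algebra K G) (basis_vec K g) = basis_vec K (inv\<^bsub>G\<^esub> g)"
  unfolding group_algebra_antipode_conv_lin_ext
  by (intro lin_ext_basis_vec[OF H _ assms] funcsetI e_closed G.inv_closed)

lemma group_algebra_counit_linear:
  "linear_map K (group_algebra K G) (regular_module K) (counit (group_algebra K G))"
proof (rule linear_map_cong[OF _ group_algebra_counit_conv_lin_ext[symmetric] H])
  show "linear_map K H (regular_module K) (lin_ext K (regular_module K) (\<lambda>_. \<one>\<^bsub>K\<^esub>))"
    unfolding linear_map_group_algebra_iff
    by (intro lin_ext_linear[OF module_regular_module[OF K]]) simp
qed

lemma group_algebra_counit_basis: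
  assumes "g \<in> carrier G"
  shows "counit (group_algebra K G) (basis_vec K g) = \<one>\<^bsub>K\<^esub>"
  unfolding group_algebra_counit_conv_lin_ext[OF e_closed[OF assms]]
  using lin_ext_basis_vec[OF module_regular_module[OF K] _ assms, of "\<lambda>_. \<one>\<^bsub>K\<^esub>"] by simp

private lemmas \<Delta> = group_algebra_comult_linear
private lemmas antipode_lin = group_algebra_antipode_linear
private lemmas \<epsilon> = group_algebra_counit_linear
private lemmas structure_basis =
  group_algebra_comult_basis group_algebra_antipode_basis group_algebra_counit_basis

private lemma \<epsilon>_closed: "x \<in> carrier H \<Longrightarrow> counit H x \<in> carrier K"
  using linear_map_closed[OF \<epsilon>] by simp

lemma linear_map_counit_smult:
  assumes "module K P" "p \<in> carrier P"
  shows "linear_map K (group_algebra K G) P (\<lambda>x. counit (group_algebra K G) x \<odot>\<^bsub>P\<^esub> p)"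
  using linear_mapD[OF \<epsilon>] by (intro linear_map_smult_const[OF assms]) auto

private lemma counit_left_bilinear: "bilinear_map K H H H (\<lambda>x y. counit H x \<odot>\<^bsub>H\<^esub> y)"
  using linear_map_scale[OF H linear_map_id] linear_map_counit_smult[OF H] \<epsilon>_closed
  by (intro bilinear_mapI) auto

private lemma counit_right_bilinear: "bilinear_map K H H H (\<lambda>x y. counit H y \<odot>\<^bsub>H\<^esub> x)"
  using linear_map_scale[OF H linear_map_id] linear_map_counit_smult[OF H] \<epsilon>_closed
  by (intro bilinear_mapI) auto

private lemma antipode_left_bilinear: "bilinear_map K H H H (\<lambda>x y. antipode H x \<otimes>\<^bsub>H\<^esub> y)"
  using bilinear_map_compose[OF antipode_lin linear_map_id mult_bilinear] by simp

private lemma antipode_right_bilinear: "bilinear_map K H H H (\<lambda>x y. x \<otimes>\<^bsub>H\<^esub> antipode H y)"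
  using bilinear_map_compose[OF linear_map_id antipode_lin mult_bilinear] by simp

text \<open>For group elements g and h both sides are gh \<otimes> gh. First \<open>y\<close>
  becomes general with the left factor a group element, then \<open>x\<close>.\<close>

lemma group_algebra_comult_mult:
  assumes "x \<in> carrier (group_algebra K G)" "y \<in> carrier (group_algebra K G)"
  shows "comult (group_algebra K G) (x \<otimes>\<^bsub>group_algebra K G\<^esub> y) =
    comult (group_algebra K G) x
      \<otimes>\<^bsub>tensor_algebra K (group_algebra K G) (group_algebra K G)\<^esub> comult (group_algebra K G) y"
proof -
  let ?A = "tensor_algebra K H H"
  have 1: "comult H (e g \<otimes>\<^bsub>H\<^esub> y) = comult H (e g) \<otimes>\<^bsub>?A\<^esub> comult H y"
    if g: "g \<in> carrier G" for g
    unfolding group_algebra_comult_basis[OF g]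
  proof (rule eqI[OF HH linear_map_compose[OF mult_right \<Delta>] linear_map_compose[OF \<Delta>
          tensor_algebra_mult_linear_right[OF H H mult_bilinear mult_bilinear]] _ assms(2)])
    fix h assume "h \<in> carrier G"
    then show "comult H (e g \<otimes>\<^bsub>H\<^esub> e h) = pure_tensor K H H (e g) (e g) \<otimes>\<^bsub>?A\<^esub> comult H (e h)"
      by (simp add: g basis_mult structure_basis e_closed
          tensor_algebra_mult_pure[OF H H mult_bilinear mult_bilinear])
  qed (rule e_closed[OF g])+
  show ?thesis
    by (rule eqI[OF HH linear_map_compose[OF mult_left \<Delta>] linear_map_compose[OF \<Delta>
            tensor_algebra_mult_linear_left[OF H H mult_bilinear mult_bilinear]] _ assms(1)])
      (simp_all add: assms(2) linear_map_closed[OF \<Delta>] 1)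
qed

lemma group_algebra_counit_mult:
  assumes "x \<in> carrier (group_algebra K G)" "y \<in> carrier (group_algebra K G)"
  shows "counit (group_algebra K G) (x \<otimes>\<^bsub>group_algebra K G\<^esub> y) =
    counit (group_algebra K G) x \<otimes>\<^bsub>K\<^esub> counit (group_algebra K G) y"
proof -
  note R = module_regular_module[OF K]
  have 1: "counit H (e g \<otimes>\<^bsub>H\<^esub> y) = counit H y" if g: "g \<in> carrier G" for g
    by (rule eqI[OF R linear_map_compose[OF mult_right \<epsilon>] \<epsilon> _ assms(2)])
      (simp_all add: g e_closed basis_mult structure_basis)
  \<comment> \<open>In \<open>regular_module K\<close> the product with the fixed scalar
    \<open>counit H y\<close> is a scalar multiple, so the lemma on counit multiples
    applies.\<close>
  have 2: "linear_map K H (regular_module K) (\<lambda>x. counit H x \<otimes>\<^bsub>K\<^esub> counit H y)"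
    using linear_map_counit_smult[OF R, of "counit H y"] \<epsilon>_closed[OF assms(2)] by simp
  show ?thesis
    by (rule eqI[OF R linear_map_compose[OF mult_left \<epsilon>] 2 _ assms(1)])
      (simp_all add: 1 assms(2) structure_basis \<epsilon>_closed)
qed

text \<open>On a group element g both sides are g \<otimes> (g \<otimes> g).\<close>

lemma group_algebra_coassoc:
  assumes "h \<in> carrier (group_algebra K G)"
  shows "tensor_assoc K (group_algebra K G) (group_algebra K G) (group_algebra K G)
      (tensor_map K (tensor_module K (group_algebra K G) (group_algebra K G)) (group_algebra K G)
        (comult (group_algebra K G)) id (comult (group_algebra K G) h)) =
    tensor_map K (group_algebra K G) (tensor_module K (group_algebra K G) (group_algebra K G))
      id (comult (group_algebra K G)) (comult (group_algebra K G) h)"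
  by (rule eqI[OF module_tensor_module[OF H HH]
        linear_map_compose[OF linear_map_compose[OF \<Delta> tensor_map_linear[OF H H HH H \<Delta> linear_map_id]]
          tensor_assoc_linear[OF H H H]]
        linear_map_compose[OF \<Delta> tensor_map_linear[OF H H H HH linear_map_id \<Delta>]] _ assms])
    (simp add: structure_basis e_closed tensor_map_pure[OF H H HH H \<Delta> linear_map_id]
      tensor_map_pure[OF H H H HH linear_map_id \<Delta>] tensor_assoc_pure[OF H H H])

lemma group_algebra_involutive:
  assumes "h \<in> carrier (group_algebra K G)"
  shows "antipode (group_algebra K G) (antipode (group_algebra K G) h) = h"
  using eqI[OF H linear_map_compose[OF antipode_lin antipode_lin] linear_map_id _ assms]
  by (simp add: structure_basis)

lemma hopf_algebra_group_algebra:
  assumes "field K"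
  shows "hopf_algebra K (group_algebra K G)"
proof (intro hopf_algebra.intro hopf_algebra_axioms.intro assms assoc_algebra_group_algebra
    group_algebra_comult_linear group_algebra_antipode_linear group_algebra_coassoc)
  show "comult H \<in> ring_hom H (tensor_algebra K H H)"
    by (rule ring_hom_memI)
      (simp_all add: linear_mapD[OF \<Delta>] group_algebra_comult_mult group_algebra_one structure_basis)
  show "counit H \<in> ring_hom H K"
    using linear_map_add[OF \<epsilon>]
    by (intro ring_hom_memI)
      (simp_all add: \<epsilon>_closed group_algebra_counit_mult group_algebra_one structure_basis)
  show "counit H (c \<odot>\<^bsub>H\<^esub> h) = c \<otimes>\<^bsub>K\<^esub> counit H h" if "c \<in> carrier K" "h \<in> carrier H" for c h
    using linear_map_smult[OF \<epsilon> that] by simp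
next
  fix h assume h: "h \<in> carrier H"
  have one: "\<one>\<^bsub>H\<^esub> \<in> carrier H" by (simp add: group_algebra_one e_closed)
  note lift = tensor_lift_linear[OF H H H] and pure = tensor_lift_pure[OF H H H]
  show "tensor_lift K H (\<lambda>x y. counit H x \<odot>\<^bsub>H\<^esub> y) (comult H h) = h"
    using eqI[OF H linear_map_compose[OF \<Delta> lift[OF counit_left_bilinear]] linear_map_id _ h]
    by (simp add: structure_basis e_closed pure[OF counit_left_bilinear])
  show "tensor_lift K H (\<lambda>x y. counit H y \<odot>\<^bsub>H\<^esub> x) (comult H h) = h"
    using eqI[OF H linear_map_compose[OF \<Delta> lift[OF counit_right_bilinear]] linear_map_id _ h]
    by (simp add: structure_basis e_closed pure[OF counit_right_bilinear])
  \<comment> \<open>At a group element, this axiom and the next say that the product with the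
    inverse, in either order, is the identity, the counit being 1 there.\<close>
  show "tensor_lift K H (\<lambda>x y. antipode H x \<otimes>\<^bsub>H\<^esub> y) (comult H h) = counit H h \<odot>\<^bsub>H\<^esub> \<one>\<^bsub>H\<^esub>"
    by (rule eqI[OF H linear_map_compose[OF \<Delta> lift[OF antipode_left_bilinear]]
          linear_map_counit_smult[OF H one] _ h])
      (simp add: structure_basis e_closed pure[OF antipode_left_bilinear] basis_mult group_algebra_one)
  show "tensor_lift K H (\<lambda>x y. x \<otimes>\<^bsub>H\<^esub> antipode H y) (comult H h) = counit H h \<odot>\<^bsub>H\<^esub> \<one>\<^bsub>H\<^esub>"
    by (rule eqI[OF H linear_map_compose[OF \<Delta> lift[OF antipode_right_bilinear]]
          linear_map_counit_smult[OF H one] _ h])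
      (simp add: structure_basis e_closed pure[OF antipode_right_bilinear] basis_mult group_algebra_one)
qed

subsection \<open>Subgroups\<close>

context
  fixes S
  assumes S: "subgroup S G"
begin

interpretation S: subgroup S G by (rule S)

private abbreviation (input) "A \<equiv> carrier (free_module K S)"

interpretation HH: module K "tensor_module K H H" by (rule HH)
interpretation A: module K "free_module K S" by (rule module_free_module[OF K])

private lemma A_subset: "A \<subseteq> carrier H"
  using free_module_carrier_mono[OF S.subset] by (simp add: group_algebra_module_simps)

private lemma A_linear:
  assumes "linear_map K H P f"
  shows "linear_map K (free_module K S) P f"
  using linear_mapD[OF assms] A_subset[THEN subsetD]
  by (intro linear_mapI) (simp_all only: group_algebra_module_simps(2-4) free_module_simps)

private lemma A_submodule: "submodule A K H"
proof (rule H.submoduleI'[OF A_subset])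
  show "\<zero>\<^bsub>H\<^esub> \<in> A"
    using A.M.zero_closed by (simp add: group_algebra_module_simps)
  show "f \<oplus>\<^bsub>H\<^esub> f' \<in> A" if "f \<in> A" "f' \<in> A" for f f'
    using A.M.a_closed[OF that] by (simp add: group_algebra_module_simps)
  show "c \<odot>\<^bsub>H\<^esub> f \<in> A" if "c \<in> carrier K" "f \<in> A" for c f
    using A.smult_closed[OF that] by (simp add: group_algebra_module_simps)
qed

text \<open>Reduces closure statements on \<open>A\<close> to elements of \<open>S\<close>; the map
  need only be linear on the whole group algebra, which is how the structure maps are known.\<close>

private lemma A_induct:
  assumes "module K P" "linear_map K H P f" "submodule V K P"
    and "\<And>g. g \<in> S \<Longrightarrow> f (e g) \<in> V" "x \<in> A"
  shows "f x \<in> V"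
proof (rule linear_map_span_subset[OF module_free_module[OF K] assms(1) A_linear[OF assms(2)] assms(3)])
  show "e ` S \<subseteq> A" using basis_vec_closed[OF K] by auto
  show "f ` e ` S \<subseteq> V" using assms(4) by auto
  show "x \<in> module_span K (free_module K S) (e ` S)"
    by (simp add: module_span_basis_vec[OF K] assms(5))
qed

private lemma A_eqI:
  assumes "module K P" "linear_map K H P f" "linear_map K H P f'"
    and "\<And>g. g \<in> S \<Longrightarrow> f (e g) = f' (e g)" "x \<in> A"
  shows "f x = f' x"
  by (rule linear_map_eqI[OF module_free_module[OF K] assms(1) A_linear[OF assms(2)]
        A_linear[OF assms(3)] module_span_basis_vec[OF K] _ assms(5)])
    (auto simp: assms(4))

lemma sub_hopf_algebra_free_module:
  "sub_hopf_algebra K (group_algebra K G) (carrier (free_module K S))"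
  unfolding sub_hopf_algebra_def
proof (intro conjI ballI A_submodule)
  note eA = basis_vec_closed[OF K, of _ S]
  show "\<one>\<^bsub>H\<^esub> \<in> A"
    by (simp add: group_algebra_one eA S.one_closed)
  fix x assume x: "x \<in> A"
  show "antipode H x \<in> A"
    by (rule A_induct[OF H group_algebra_antipode_linear A_submodule _ x])
      (simp add: group_algebra_antipode_basis eA)
  let ?P = "{pure_tensor K H H a b | a b. a \<in> A \<and> b \<in> A}"
  have P: "?P \<subseteq> carrier (tensor_module K H H)"
    using A_subset pure_tensor_closed[OF H H] by blast
  show "comult H x \<in> module_span K (tensor_module K H H) ?P"
  proof (rule A_induct[OF HH group_algebra_comult_linear HH.module_span_submodule[OF P] _ x])
    fix g assume "g \<in> S"
    then show "comult H (e g) \<in> module_span K (tensor_module K H H) ?P"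
      by (intro subsetD[OF module_span_superset])
        (auto simp: group_algebra_comult_basis intro: eA)
  qed
  fix y assume y: "y \<in> A"
  \<comment> \<open>Closure under products in two passes: the right factor is made general here, the
    left one in the next step.\<close>
  have "e g \<otimes>\<^bsub>H\<^esub> y \<in> A" if "g \<in> S" for g
    by (rule A_induct[OF H bilinear_mapD(1)[OF mult_bilinear] A_submodule _ y])
      (simp_all add: that e_closed group_algebra_basis_mult eA)
  then show "x \<otimes>\<^bsub>H\<^esub> y \<in> A"
    using y A_subset by (intro A_induct[OF H bilinear_mapD(2)[OF mult_bilinear] A_submodule _ x]) auto
qed

lemma finite_dimensional_restrict_group_algebra:
  assumes "finite S"
  shows "finite_dimensional K (restrict_hopf K (group_algebra K G) (carrier (free_module K S)))"
proof -
  have "module_span K (restrict_hopf K H A) (e ` S) = module_span K (free_module K S) (e ` S)"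
    by (rule module_span_cong) (simp_all add: group_algebra_module_simps)
  then show ?thesis
    unfolding finite_dimensional_def using assms basis_vec_closed[OF K]
    by (intro exI[of _ "e ` S"]) (auto simp: module_span_basis_vec[OF K])
qed

lemma involutive_restrict_group_algebra:
  "involutive (restrict_hopf K (group_algebra K G) (carrier (free_module K S)))"
  using A_subset by (auto simp: involutive_def group_algebra_involutive)

lemma unimodular_restrict_group_algebra:
  "unimodular (restrict_hopf K (group_algebra K G) (carrier (free_module K S)))"
proof -
  \<comment> \<open>A description that does not mention a side, with the value at the identity as
    reference; both spaces of integrals are compared with it.\<close>
  let ?C = "{h \<in> A. \<forall>g\<in>S. h g = h \<one>\<^bsub>G\<^esub>}"
  note counit_basis = group_algebra_counit_basis
  have outside: "h x = \<zero>\<^bsub>K\<^esub>" if "h \<in> A" "x \<notin> S" for h x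
    using that by (simp add: free_module_carrier)
  have left_translate: "e g \<otimes>\<^bsub>H\<^esub> h = h" and right_translate: "h \<otimes>\<^bsub>H\<^esub> e g = h"
    if h: "h \<in> ?C" and g: "g \<in> S" for h g
  proof -
    have hA: "h \<in> A" and h_S: "\<And>x. x \<in> S \<Longrightarrow> h x = h \<one>\<^bsub>G\<^esub>" using h by blast+
    have hH: "h \<in> carrier H" and gG: "g \<in> carrier G" using hA g A_subset by auto
    have zero: "h x = \<zero>\<^bsub>K\<^esub>" if "x \<notin> S" for x
      by (rule outside[OF hA that])
    \<comment> \<open>Such an \<open>h\<close> depends only on whether its argument lies in
      \<open>S\<close>, and translation by an element of \<open>S\<close> does not change
      that.\<close>
    have const: "h x = h y" if "x \<in> S \<longleftrightarrow> y \<in> S" for x y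
    proof (cases "x \<in> S")
      case True
      with that have "y \<in> S" by blast
      show ?thesis by (rule trans[OF h_S[OF True] h_S[OF \<open>y \<in> S\<close>, symmetric]])
    next
      case False
      with that have "y \<notin> S" by blast
      show ?thesis by (rule trans[OF zero[OF False] zero[OF \<open>y \<notin> S\<close>, symmetric]])
    qed
    show "e g \<otimes>\<^bsub>H\<^esub> h = h"
    proof
      fix x
      show "(e g \<otimes>\<^bsub>H\<^esub> h) x = h x"
      proof (cases "x \<in> carrier G")
        case True
        then have "g \<otimes>\<^bsub>G\<^esub> (inv\<^bsub>G\<^esub> g \<otimes>\<^bsub>G\<^esub> x) = x" using gG by (simp add: G.m_assoc[symmetric])
        then have "h (inv\<^bsub>G\<^esub> g \<otimes>\<^bsub>G\<^esub> x) = h x"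
          using S.m_closed[OF g, of "inv\<^bsub>G\<^esub> g \<otimes>\<^bsub>G\<^esub> x"] S.m_closed[OF S.m_inv_closed[OF g], of x]
          by (intro const) auto
        then show ?thesis
          using True by (simp add: group_algebra_basis_mult_left[OF gG hH])
      next
        case False
        then have "x \<notin> S" using S.subset by blast
        then show ?thesis
          using False by (simp add: group_algebra_mult_outside[OF e_closed[OF gG] hH] zero)
      qed
    qed
    show "h \<otimes>\<^bsub>H\<^esub> e g = h"
    proof
      fix x
      show "(h \<otimes>\<^bsub>H\<^esub> e g) x = h x"
      proof (cases "x \<in> carrier G")
        case True
        have eq: "(x \<otimes>\<^bsub>G\<^esub> inv\<^bsub>G\<^esub> g) \<otimes>\<^bsub>G\<^esub> g = x"
          unfolding G.m_assoc[OF True G.inv_closed[OF gG] gG] G.l_inv[OF gG] by (rule G.r_one[OF True])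
        have "h (x \<otimes>\<^bsub>G\<^esub> inv\<^bsub>G\<^esub> g) = h x"
        proof (rule const, rule iffI)
          assume "x \<otimes>\<^bsub>G\<^esub> inv\<^bsub>G\<^esub> g \<in> S"
          from S.m_closed[OF this g] show "x \<in> S" unfolding eq .
        next
          assume "x \<in> S"
          from S.m_closed[OF this S.m_inv_closed[OF g]] show "x \<otimes>\<^bsub>G\<^esub> inv\<^bsub>G\<^esub> g \<in> S" .
        qed
        then show ?thesis
          using True by (simp add: group_algebra_basis_mult_right[OF gG hH])
      next
        case False
        then have "x \<notin> S" using S.subset by blast
        then show ?thesis
          using False by (simp add: group_algebra_mult_outside[OF hH e_closed[OF gG]] zero)
      qed
    qed
  qed
  have "left_integrals (restrict_hopf K H A) = ?C"
  proof (intro equalityI subsetI)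
    fix h assume "h \<in> left_integrals (restrict_hopf K H A)"
    then have h: "h \<in> A" and int: "\<And>y. y \<in> A \<Longrightarrow> y \<otimes>\<^bsub>H\<^esub> h = counit H y \<odot>\<^bsub>H\<^esub> h"
      by (simp_all add: left_integrals_def)
    have hH: "h \<in> carrier H" using h A_subset by blast
    have "h g = h \<one>\<^bsub>G\<^esub>" if g: "g \<in> S" for g
    proof -
      have gG: "g \<in> carrier G" using g by simp
      \<comment> \<open>The integral equation at the basis vector of \<open>g\<close>, where the
        counit is 1. Evaluated at \<open>g\<close>, its left side is the value of \<open>h\<close>
        at the identity.\<close>
      have "e g \<otimes>\<^bsub>H\<^esub> h = h"
        using int[OF basis_vec_closed[OF K g]] hH by (simp add: counit_basis[OF gG])
      then show ?thesis
        using group_algebra_basis_mult_left[OF gG hH gG] gG by simp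
    qed
    then show "h \<in> ?C" using h by blast
  next
    fix h assume h: "h \<in> ?C"
    then have hH: "h \<in> carrier H" using A_subset by blast
    \<comment> \<open>Both sides are linear in \<open>y\<close>, so translation invariance under
      \<open>S\<close> is enough.\<close>
    have "y \<otimes>\<^bsub>H\<^esub> h = counit H y \<odot>\<^bsub>H\<^esub> h" if "y \<in> A" for y
      by (rule A_eqI[OF H bilinear_mapD(2)[OF mult_bilinear hH] linear_map_counit_smult[OF H hH] _ that])
        (simp add: left_translate[OF h] counit_basis hH)
    then show "h \<in> left_integrals (restrict_hopf K H A)"
      using h by (simp add: left_integrals_def)
  qed
  moreover have "right_integrals (restrict_hopf K H A) = ?C"
  proof (intro equalityI subsetI)
    fix h assume "h \<in> right_integrals (restrict_hopf K H A)"
    then have h: "h \<in> A" and int: "\<And>y. y \<in> A \<Longrightarrow> h \<otimes>\<^bsub>H\<^esub> y = counit H y \<odot>\<^bsub>H\<^esub> h"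
      by (simp_all add: right_integrals_def)
    have hH: "h \<in> carrier H" using h A_subset by blast
    have "h g = h \<one>\<^bsub>G\<^esub>" if g: "g \<in> S" for g
    proof -
      have gG: "g \<in> carrier G" using g by simp
      have "h \<otimes>\<^bsub>H\<^esub> e g = h"
        using int[OF basis_vec_closed[OF K g]] hH by (simp add: counit_basis[OF gG])
      then show ?thesis
        using group_algebra_basis_mult_right[OF gG hH gG] gG by simp
    qed
    then show "h \<in> ?C" using h by blast
  next
    fix h assume h: "h \<in> ?C"
    then have hH: "h \<in> carrier H" using A_subset by blast
    have "h \<otimes>\<^bsub>H\<^esub> y = counit H y \<odot>\<^bsub>H\<^esub> h" if "y \<in> A" for y
      by (rule A_eqI[OF H bilinear_mapD(1)[OF mult_bilinear hH] linear_map_counit_smult[OF H hH] _ that])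
        (simp add: right_translate[OF h] counit_basis hH)
    then show "h \<in> right_integrals (restrict_hopf K H A)"
      using h by (simp add: right_integrals_def)
  qed
  ultimately show ?thesis by (simp add: unimodular_def)
qed

end

end

section \<open>The directed system\<close>

text \<open>Scalar multiplication is pointwise whatever \<open>U\<close> is. With \<open>U\<close>
  the whole group and \<open>x\<close> its identity, this identifies the initial member of the
  system with the scalars.\<close>

lemma free_module_singleton:
  assumes "cring K"
  shows "carrier (free_module K {x}) = {c \<odot>\<^bsub>free_module K U\<^esub> basis_vec K x | c. c \<in> carrier K}"
proof (intro equalityI subsetI)
  interpret cring K by (rule assms)
  fix f assume f: "f \<in> carrier (free_module K {x})"
  have "f = f x \<odot>\<^bsub>free_module K U\<^esub> basis_vec K x"
    using free_module_carrierD[OF f] by (auto simp: basis_vec_def)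
  then show "f \<in> {c \<odot>\<^bsub>free_module K U\<^esub> basis_vec K x | c. c \<in> carrier K}"
    using free_module_carrierD(1)[OF f] by blast
next
  interpret module K "free_module K {x}" by (rule module_free_module[OF assms])
  fix f assume "f \<in> {c \<odot>\<^bsub>free_module K U\<^esub> basis_vec K x | c. c \<in> carrier K}"
  then obtain c where c: "c \<in> carrier K" "f = c \<odot>\<^bsub>free_module K U\<^esub> basis_vec K x"
    by blast
  have "c \<odot>\<^bsub>free_module K {x}\<^esub> basis_vec K x \<in> carrier (free_module K {x})"
    by (intro smult_closed basis_vec_closed[OF assms] c(1)) simp
  then show "f \<in> carrier (free_module K {x})" by (simp add: c(2))
qed

lemma (in locally_finite_group) index_shape_finite_subgroups:
  assumes inf: "infinite (carrier G)"
  defines "\<Lambda> \<equiv> {S. subgroup S G \<and> finite S}"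
  shows "index_shape \<Lambda> {(S, S'). S \<in> \<Lambda> \<and> S' \<in> \<Lambda> \<and> S \<subseteq> S'} {\<one>}" (is "index_shape _ ?r _")
proof -
  have sub: "S \<subseteq> carrier G" if "S \<in> \<Lambda>" for S
    using that by (auto simp: \<Lambda>_def dest: subgroup.subset)
  have ex: "\<exists>S\<in>\<Lambda>. X \<subseteq> S" if "finite X" "X \<subseteq> carrier G" for X
    using finite_subset_in_finite_subgroup[OF that] by (auto simp: \<Lambda>_def)
  have bot: "{\<one>} \<in> \<Lambda>"
    using triv_subgroup by (simp add: \<Lambda>_def)
  have least: "{\<one>} \<subseteq> S" if "S \<in> \<Lambda>" for S
    using that by (auto simp: \<Lambda>_def dest: subgroup.one_closed)
  have inf': "infinite \<Lambda>"
  proof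
    assume "finite \<Lambda>"
    \<comment> \<open>Every element lies in some finite subgroup, so \<open>G\<close> would be a
      finite union of finite sets.\<close>
    then have "finite (\<Union>\<Lambda>)" by (auto simp: \<Lambda>_def)
    moreover have "carrier G \<subseteq> \<Union>\<Lambda>"
    proof
      fix g assume "g \<in> carrier G"
      then show "g \<in> \<Union>\<Lambda>" using ex[of "{g}"] by auto
    qed
    ultimately show False using inf finite_subset by blast
  qed
  have order: "partial_order_on \<Lambda> ?r"
    unfolding partial_order_on_def preorder_on_def
  proof (intro conjI)
    show "refl_on \<Lambda> ?r" by (rule refl_onI) simp
    show "trans ?r" by (rule transI) auto
    show "antisym ?r" by (rule antisymI) auto
  qed auto
  have up: "\<exists>U\<in>\<Lambda>. (S, U) \<in> ?r \<and> (S', U) \<in> ?r" if SS': "S \<in> \<Lambda>" "S' \<in> \<Lambda>" for S S'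
  proof -
    \<comment> \<open>The union of two subgroups need not be a subgroup; local finiteness encloses
      this finite set in one.\<close>
    have "finite (S \<union> S')" using SS' by (auto simp: \<Lambda>_def)
    then obtain U where "U \<in> \<Lambda>" "S \<union> S' \<subseteq> U" using ex[of "S \<union> S'"] sub SS' by auto
    then show ?thesis using SS' by (intro bexI[of _ U]) simp_all
  qed
  have bigger: "\<exists>U\<in>\<Lambda>. (S, U) \<in> ?r \<and> S \<noteq> U" if S: "S \<in> \<Lambda>" for S
  proof -
    have fin: "finite S" using S by (simp add: \<Lambda>_def)
    then have "\<not> carrier G \<subseteq> S" using inf finite_subset by blast
    \<comment> \<open>A finite subgroup misses some element; adjoining it and enclosing the result
      gives a strictly larger member.\<close>
    then obtain g where g: "g \<in> carrier G" "g \<notin> S" by blast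
    then obtain U where "U \<in> \<Lambda>" "insert g S \<subseteq> U" using ex[of "insert g S"] sub[OF S] fin by auto
    then show ?thesis using S g by (intro bexI[of _ U]) auto
  qed
  have least': "\<forall>S\<in>\<Lambda>. ({\<one>}, S) \<in> ?r"
    using bot least by auto
  have unique: "S = {\<one>}" if "S \<in> \<Lambda>" "\<forall>U\<in>\<Lambda>. (S, U) \<in> ?r" for S
    using bspec[OF that(2) bot] least[OF that(1)] by simp
  show ?thesis
    unfolding index_shape_def
    by (intro conjI inf' order bot least' ballI impI up bigger) (assumption | rule unique)+
qed

theorem proposition7p1:
  fixes K :: "('k, 'r) ring_scheme" and G :: "('g, 'm) monoid_scheme"
  assumes "field K"
    and "locally_finite_group G"
    and "infinite (carrier G)"
  shows "locally_Frobenius_hopf_algebra K (group_algebra K G)"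
proof -
  interpret K: field K by (rule assms)
  interpret G: locally_finite_group G by (rule assms)
  note K = K.is_cring and G = G.group_axioms
  let ?\<Lambda> = "{S. subgroup S G \<and> finite S}" and ?F = "\<lambda>S. carrier (free_module K S)"
  let ?r = "{(S, S'). S \<in> ?\<Lambda> \<and> S' \<in> ?\<Lambda> \<and> S \<subseteq> S'}"
  let ?H = "group_algebra K G"
  have union: "carrier ?H = (\<Union>S\<in>?\<Lambda>. ?F S)"
    unfolding group_algebra_module_simps
  proof (intro equalityI subsetI)
    fix f assume f: "f \<in> carrier (free_module K (carrier G))"
    \<comment> \<open>Local finiteness is applied to the support of \<open>f\<close>, which is
      finite by definition of the free module.\<close>
    from G.finite_subset_in_finite_subgroup[OF free_module_carrierD(2,4)[OF f]]
    obtain S where S: "subgroup S G" "finite S" "{x. f x \<noteq> \<zero>\<^bsub>K\<^esub>} \<subseteq> S"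
      by blast
    have "f \<in> ?F S"
      using free_module_carrierD(1,2)[OF f] S(3) by (simp add: free_module_def)
    then show "f \<in> (\<Union>S\<in>?\<Lambda>. ?F S)" using S(1,2) by blast
  next
    fix f assume "f \<in> (\<Union>S\<in>?\<Lambda>. ?F S)"
    then obtain S where "subgroup S G" "f \<in> ?F S" by blast
    then show "f \<in> carrier (free_module K (carrier G))"
      using free_module_carrier_mono[OF subgroup.subset, of S G K] by blast
  qed
  have bot: "?F {\<one>\<^bsub>G\<^esub>} = {c \<odot>\<^bsub>?H\<^esub> \<one>\<^bsub>?H\<^esub> | c. c \<in> carrier K}"
    unfolding group_algebra_one group_algebra_module_simps by (rule free_module_singleton[OF K])
  have mono: "?F S \<subset> ?F S'" if "(S, S') \<in> ?r \<and> S \<noteq> S'" for S S'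
  proof -
    have "S \<subseteq> S'" "\<not> S' \<subseteq> S" using that by auto
    then show ?thesis
      unfolding less_le_not_le free_module_carrier_subset_iff[OF K K.one_not_zero] by (rule conjI)
  qed
  have sub: "sub_hopf_algebra K ?H (?F S) \<and> finite_dimensional K (restrict_hopf K ?H (?F S)) \<and>
      involutive (restrict_hopf K ?H (?F S)) \<and> unimodular (restrict_hopf K ?H (?F S))"
    if S: "S \<in> ?\<Lambda>" for S
  proof -
    have "subgroup S G" "finite S" using S by simp_all
    then show ?thesis
      by (intro conjI sub_hopf_algebra_free_module[OF K G] finite_dimensional_restrict_group_algebra[OF K G]
          involutive_restrict_group_algebra[OF K G] unimodular_restrict_group_algebra[OF K G])
  qed
  have "locally_Frobenius_system K ?H ?\<Lambda> ?r {\<one>\<^bsub>G\<^esub>} ?F"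
    unfolding locally_Frobenius_system_def
    by (rule conjI[OF G.index_shape_finite_subgroups[OF assms(3)]], rule conjI, rule ballI, erule sub,
        rule conjI, intro ballI impI, erule mono, rule conjI[OF bot union])
  \<comment> \<open>The indices are subsets of \<open>G\<close>, whereas the definition asks for
    sets of elements of the algebra; \<open>locally_Frobenius_systemD\<close> reindexes the system
    by its own members.\<close>
  then show ?thesis
    by (rule locally_Frobenius_systemD[OF hopf_algebra_group_algebra[OF K G assms(1)]])
qed

end
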